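(* Assume that the target density $f=F'$ satisfies $$\int_0^\infty x f(x)\,dx<\infty\quad\text{and}\quad\int_0^\infty x^2\big(f(x)+xf'(x)\big)^2dx<\infty.$$ Then, as $n\to\infty$, $$\mathrm{MISE}(\hat F_{n,b}^{\mathrm{LN}}) = \int_0^\infty\mathrm{Var}(\hat F_{n,b}^{\mathrm{LN}}(x))\,dx+\int_0^\infty\big(\mathrm{Bias}[\hat F_{n,b}^{\mathrm{LN}}(x)]\big)^2dx$$ $$= n^{-1}\int_0^\infty F(x)(1-F(x))\,dx - n^{-1}b^{1/2}\int_0^\infty\frac{x f(x)}{\sqrt{\pi}}\,dx + b^2\int_0^\infty\frac{x^2}{4}\big(f(x)+xf'(x)\big)^2dx + o(n^{-1}b^{1/2})+o(b^2).$$ In particular, if $\int_0^\infty x^2(f(x)+xf'(x))^2dx>0$, the asymptotically optimal choice of $b$, with respect to $\mathrm{MISE}$, is $$b_{\mathrm{opt}} = n^{-2/3}\left[\frac{4\int_0^\infty\frac{x^2}{4}(f(x)+xf'(x))^2dx}{\int_0^\infty x f(x)/\sqrt{\pi}\,dx}\right]^{-2/3},$$ with $$\mathrm{MISE}(\hat F_{n,b_{\mathrm{opt}}}^{\mathrm{LN}}) = n^{-1}\int_0^\infty F(x)(1-F(x))\,dx - n^{-4/3}\,\frac34\left[\frac{\big(\int_0^\infty x f(x)/\sqrt{\pi}\,dx\big)^4}{4\int_0^\infty\frac{x^2}{4}(f(x)+xf'(x))^2dx}\right]^{1/3}+o(n^{-4/3}).$$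
   Context: $F$ is a cumulative distribution function supported on $[0,\infty)$ having two continuous and bounded derivatives; $f=F'$. $X_1,X_2,\dots$ are i.i.d. with c.d.f. $F$. The smoothing parameter $b=b_n>0$ satisfies $b\to0$ as $n\to\infty$. The lognormal kernel c.d.f. estimator is, for $x\in(0,\infty)$, $$\hat F_{n,b}^{\mathrm{LN}}(x):=\frac1n\sum_{i=1}^n\overline K_{\mathrm{LN}}(X_i\mid\log x,\sqrt b),\qquad \overline K_{\mathrm{LN}}(t\mid\mu,\sigma):=1-\Phi\Big(\frac{\log t-\mu}{\sigma}\Big),$$ where $\Phi$ is the c.d.f. of the standard normal distribution. For an estimator $\hat F$, $\mathrm{Bias}[\hat F(x)]:=\mathbb{E}[\hat F(x)]-F(x)$ and $\mathrm{MISE}(\hat F):=\mathbb{E}\int_0^\infty(\hat F(x)-F(x))^2dx$. "Asymptotically optimal choice of $b$ with respect to MISE" means the minimizer over $b>0$ of the expansion of the MISE with the error terms $o(n^{-1}b^{1/2})$ and $o(b^2)$ dropped. Notation: $u=o(v)$ means $\lim|u/v|=0$ as $n\to\infty$. *)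

theory Defs
  imports "HOL-Probability.Probability" "HOL-Library.Landau_Symbols"
begin

definition std_normal_cdf :: "real \<Rightarrow> real" where
  "std_normal_cdf = cdf std_normal_distribution"

definition lognormal_kernel_survival :: "real \<Rightarrow> real \<Rightarrow> real \<Rightarrow> real" where
  "lognormal_kernel_survival t \<mu> \<sigma> = 1 - std_normal_cdf ((ln t - \<mu>) / \<sigma>)"

text \<open>
  An estimator of a c.d.f. is a function of the sample point and of the argument \<open>x\<close>;
  only \<open>x > 0\<close> is used. The observations are \<open>X 1, \<dots>, X n\<close>. They are almost surely
  positive where this is applied, so the value of \<open>ln\<close> outside \<open>(0, \<infinity>)\<close> is immaterial.
\<close>

definition LN_estimator ::
    "(nat \<Rightarrow> 'a \<Rightarrow> real) \<Rightarrow> nat \<Rightarrow> real \<Rightarrow> 'a \<Rightarrow> real \<Rightarrow> real" where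
  "LN_estimator X n b \<omega> x =
     (1 / real n) * (\<Sum>i=1..n. lognormal_kernel_survival (X i \<omega>) (ln x) (sqrt b))"

definition bias :: "'a measure \<Rightarrow> (real \<Rightarrow> real) \<Rightarrow> ('a \<Rightarrow> real \<Rightarrow> real) \<Rightarrow> real \<Rightarrow> real" where
  "bias M F Fhat x = (\<integral>\<omega>. Fhat \<omega> x \<partial>M) - F x"

text \<open>
  Integrals in \<open>[0, \<infinity>]\<close>, so that no integrability is presupposed.
\<close>

definition MISE :: "'a measure \<Rightarrow> (real \<Rightarrow> real) \<Rightarrow> ('a \<Rightarrow> real \<Rightarrow> real) \<Rightarrow> ennreal" where
  "MISE M F Fhat =
     (\<integral>\<^sup>+\<omega>. (\<integral>\<^sup>+x\<in>{0<..}. ennreal ((Fhat \<omega> x - F x)\<^sup>2) \<partial>lborel) \<partial>M)"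

text \<open>
  In the following, \<open>f\<close> and \<open>f'\<close> stand for the first two derivatives of \<open>F\<close> on \<open>(0, \<infinity>)\<close>.
\<close>

definition LN_var_const :: "(real \<Rightarrow> real) \<Rightarrow> real" where
  "LN_var_const f = (LBINT x:{0<..}. x * f x / sqrt pi)"

definition LN_bias_const :: "(real \<Rightarrow> real) \<Rightarrow> (real \<Rightarrow> real) \<Rightarrow> real" where
  "LN_bias_const f f' = (LBINT x:{0<..}. x\<^sup>2 / 4 * (f x + x * f' x)\<^sup>2)"

text \<open>
  The expansion of the MISE with the error terms dropped.
\<close>

definition LN_AMISE ::
    "(real \<Rightarrow> real) \<Rightarrow> (real \<Rightarrow> real) \<Rightarrow> (real \<Rightarrow> real) \<Rightarrow> nat \<Rightarrow> real \<Rightarrow> real" where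
  "LN_AMISE F f f' n b =
     (1 / real n) * (LBINT x:{0<..}. F x * (1 - F x))
     - (1 / real n) * sqrt b * LN_var_const f
     + b\<^sup>2 * LN_bias_const f f'"

definition LN_b_opt :: "(real \<Rightarrow> real) \<Rightarrow> (real \<Rightarrow> real) \<Rightarrow> nat \<Rightarrow> real" where
  "LN_b_opt f f' n =
     real n powr (- 2 / 3) * (4 * LN_bias_const f f' / LN_var_const f) powr (- 2 / 3)"

end

theory Submission
  imports Defs
begin

text \<open>
  Let \<open>\<sigma> = b\<^sup>1\<^sup>/\<^sup>2\<close> and let \<open>Z, Z\<^sub>1, Z\<^sub>2\<close> be independent standard normal. The kernel at \<open>t\<close> is the
  probability of \<open>t < x exp (\<sigma> Z)\<close>, and its square is that of \<open>t < x exp (\<sigma> min Z\<^sub>1 Z\<^sub>2)\<close>. Hence the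
  estimator has mean \<open>G x = E F (x exp (\<sigma> Z))\<close> and variance \<open>(G\<^sub>2 x - (G x)\<^sup>2) / n\<close> with
  \<open>G\<^sub>2 x = E F (x exp (\<sigma> min Z\<^sub>1 Z\<^sub>2))\<close>.

  Scaling gives \<open>\<integral> (G\<^sub>2 - F) = - (E exp (- \<sigma> min Z\<^sub>1 Z\<^sub>2) - 1) \<integral> x f x\<close> exactly, and this carries the
  whole term of order \<open>\<sigma>\<close>, since \<open>E min Z\<^sub>1 Z\<^sub>2 = - 1 / \<pi>\<^sup>1\<^sup>/\<^sup>2\<close>: the other part, \<open>\<integral> (G\<^sup>2 - F\<^sup>2)\<close>, is
  \<open>o(\<sigma>)\<close>. For the latter and for the bias one expands \<open>F (x exp s)\<close> in \<open>s\<close>. The remainders are averages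
  of differences \<open>H (x exp s) - H x\<close>, and they vanish in \<open>L\<^sup>1\<close> and \<open>L\<^sup>2\<close> because dilations act
  continuously on these spaces.
\<close>

text \<open>The moment hypotheses shape the argument: \<open>g x = x * f x\<close> is assumed
  integrable, but \<open>h x = x * (f x + x * f' x)\<close> only square integrable. A second-order
  expansion can therefore not be integrated over \<open>x\<close> in the variance; a first-order one
  has to do. For \<open>G\<close> it does, because \<open>E Z = 0\<close> cancels the linear term
  and leaves \<open>\<sigma>\<close> times an average of differences of \<open>g\<close>. For
  \<open>G\<^sub>2\<close> the minimum has nonzero mean and the linear term survives, which is why
  that integral is evaluated exactly, as a first moment of a product of independent variables. The
  bias does get the second-order expansion, since only its square is integrated: with
  \<open>E Z\<^sup>2 = 1\<close>, the bias divided by \<open>\<sigma>\<^sup>2\<close> tends to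
  \<open>h / 2\<close> in L^2. Apart from the factor \<open>1 / n\<close> of the variance, nothing
  depends on \<open>n\<close>: the integrals are functions of \<open>\<sigma>\<close> alone. Two
  one-sided limits at \<open>\<sigma> = 0\<close> thus give the expansion for every bandwidth
  sequence, including the optimal one, for which both error terms have order n^(-4/3).\<close>

section \<open>Dominated convergence and continuity of dilations in L^1 and L^2\<close>

text \<open>Pratt's form of dominated convergence. Both \<open>min (u n x) (V x)\<close> and the
  positive part of \<open>V x - v n x\<close> are dominated by the fixed \<open>V\<close>;
  \<open>u n\<close> exceeds their sum by at most \<open>v n - V\<close>, whose integral vanishes in
  the limit by \<open>int_lim\<close>.\<close>

lemma dominated_convergence_moving_bound:
  fixes u v :: "nat \<Rightarrow> 'a \<Rightarrow> real" and V :: "'a \<Rightarrow> real"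
  assumes [measurable]: "\<And>n. u n \<in> borel_measurable M"
    and v: "\<And>n. integrable M (v n)" and V: "integrable M V"
    and bound: "\<And>n x. 0 \<le> u n x" "\<And>n x. u n x \<le> v n x"
    and u_lim: "\<And>x. (\<lambda>n. u n x) \<longlonglongrightarrow> 0"
    and v_lim: "\<And>x. (\<lambda>n. v n x) \<longlonglongrightarrow> V x"
    and int_lim: "(\<lambda>n. \<integral>x. v n x \<partial>M) \<longlonglongrightarrow> (\<integral>x. V x \<partial>M)"
  shows "(\<lambda>n. \<integral>x. u n x \<partial>M) \<longlonglongrightarrow> 0"
proof -
  have [measurable]: "v n \<in> borel_measurable M" "V \<in> borel_measurable M" for n
    using v V by auto
  have V0: "0 \<le> V x" for x
    using tendsto_lowerbound[OF v_lim] bound by (meson eventually_sequentiallyI order_trans sequentially_bot)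
  have u: "integrable M (u n)" for n
    by (rule Bochner_Integration.integrable_bound[OF v[of n]]) (auto intro!: order_trans[OF bound(2) abs_ge_self] simp: bound)
  have A: "(\<lambda>n. \<integral>x. min (u n x) (V x) \<partial>M) \<longlonglongrightarrow> (\<integral>x. 0 \<partial>M)"
  proof (rule integral_dominated_convergence[OF _ _ V])
    show "AE x in M. (\<lambda>n. min (u n x) (V x)) \<longlonglongrightarrow> 0"
    proof (rule AE_I2)
      show "(\<lambda>n. min (u n x) (V x)) \<longlonglongrightarrow> 0" for x
        using tendsto_min[OF u_lim[of x] tendsto_const[of "V x"]] V0[of x] by (simp add: min_absorb1)
    qed
    show "AE x in M. norm (min (u n x) (V x)) \<le> V x" for n
      using bound V0 by (auto simp: min_def)
  qed auto
  have B: "(\<lambda>n. \<integral>x. max 0 (V x - v n x) \<partial>M) \<longlonglongrightarrow> (\<integral>x. 0 \<partial>M)"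
  proof (rule integral_dominated_convergence[OF _ _ V])
    show "AE x in M. (\<lambda>n. max 0 (V x - v n x)) \<longlonglongrightarrow> 0"
    proof (rule AE_I2)
      show "(\<lambda>n. max 0 (V x - v n x)) \<longlonglongrightarrow> 0" for x
        using tendsto_max[OF tendsto_const[of 0] tendsto_diff[OF tendsto_const[of "V x"] v_lim[of x]]] by simp
    qed
    show "AE x in M. norm (max 0 (V x - v n x)) \<le> V x" for n
      using bound V0 by (intro AE_I2) (smt (verit) order_trans real_norm_def)
  qed auto
  have iA: "integrable M (\<lambda>x. min (u n x) (V x))" for n
    using u V by (rule integrable_min)
  have iB: "integrable M (\<lambda>x. max 0 (V x - v n x))" for n
    using v V by (intro integrable_max) auto
  have le: "(\<integral>x. u n x \<partial>M) \<le> (\<integral>x. min (u n x) (V x) \<partial>M) + (\<integral>x. max 0 (V x - v n x) \<partial>M)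
      + ((\<integral>x. v n x \<partial>M) - (\<integral>x. V x \<partial>M))" for n
  proof -
    have "(\<integral>x. u n x \<partial>M) \<le> (\<integral>x. min (u n x) (V x) + max 0 (V x - v n x) + (v n x - V x) \<partial>M)"
    proof (rule integral_mono)
      show "u n x \<le> min (u n x) (V x) + max 0 (V x - v n x) + (v n x - V x)" for x
        using bound(2)[of n x] by (simp add: min_def max_def)
    qed (use iA iB u v V in auto)
    then show ?thesis
      using iA iB v V by simp
  qed
  have lim: "(\<lambda>n. (\<integral>x. min (u n x) (V x) \<partial>M) + (\<integral>x. max 0 (V x - v n x) \<partial>M)
      + ((\<integral>x. v n x \<partial>M) - (\<integral>x. V x \<partial>M))) \<longlonglongrightarrow> 0"
    using tendsto_add[OF tendsto_add[OF A B] tendsto_diff[OF int_lim tendsto_const[of "\<integral>x. V x \<partial>M"]]] by simp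
  show ?thesis
  proof (rule tendsto_sandwich[OF _ _ tendsto_const lim])
    show "\<forall>\<^sub>F n in sequentially. 0 \<le> (\<integral>x. u n x \<partial>M)"
      using bound(1) by (intro always_eventually allI integral_nonneg_AE) simp
  qed (use le in \<open>simp add: always_eventually\<close>)
qed

lemma nn_integral_dilation:
  fixes H :: "real \<Rightarrow> ennreal"
  assumes [measurable]: "H \<in> borel_measurable borel"
  shows "(\<integral>\<^sup>+x. H (x * exp s) \<partial>lborel) = ennreal (exp (- s)) * (\<integral>\<^sup>+x. H x \<partial>lborel)"
proof -
  have "(\<integral>\<^sup>+x. H x \<partial>lborel) = ennreal (exp s) * (\<integral>\<^sup>+x. H (x * exp s) \<partial>lborel)"
    using nn_integral_real_affine[of H "exp s" 0] by (simp add: mult.commute)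
  then have "ennreal (exp (- s)) * (\<integral>\<^sup>+x. H x \<partial>lborel) =
      ennreal (exp (- s) * exp s) * (\<integral>\<^sup>+x. H (x * exp s) \<partial>lborel)"
    by (simp add: ennreal_mult mult.assoc)
  then show ?thesis
    by (simp add: exp_minus)
qed

lemma integral_dilation:
  fixes H :: "real \<Rightarrow> real"
  assumes "integrable lborel H"
  shows "integrable lborel (\<lambda>x. H (x * exp s))"
    and "(\<integral>x. H (x * exp s) \<partial>lborel) = exp (- s) * (\<integral>x. H x \<partial>lborel)"
proof -
  show "integrable lborel (\<lambda>x. H (x * exp s))"
    using lborel_integrable_real_affine[OF assms, of "exp s" 0] by (simp add: mult.commute)
  have "(\<integral>x. H x \<partial>lborel) = exp s * (\<integral>x. H (x * exp s) \<partial>lborel)"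
    using lborel_integral_real_affine[of "exp s" H 0] by (simp add: mult.commute)
  then show "(\<integral>x. H (x * exp s) \<partial>lborel) = exp (- s) * (\<integral>x. H x \<partial>lborel)"
    by (simp add: exp_minus)
qed

text \<open>The exponent 1 serves \<open>g\<close> and the exponent 2 serves \<open>h\<close>; a
  common constant lets the dilation lemmas treat both at once.\<close>

lemma abs_diff_power_le:
  fixes a b :: real
  assumes "1 \<le> p" "p \<le> 2"
  shows "\<bar>a - b\<bar> ^ p \<le> 2 * \<bar>a\<bar> ^ p + 2 * \<bar>b\<bar> ^ p"
proof -
  have "(a - b)\<^sup>2 \<le> 2 * a\<^sup>2 + 2 * b\<^sup>2"
    using zero_le_power2[of "a + b"] unfolding power2_sum power2_diff by linarith
  moreover have "p = 1 \<or> p = 2"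
    using assms by auto
  ultimately show ?thesis
    by auto
qed

text \<open>
  Dilations act continuously on \<open>L\<^sup>p\<close>. Pointwise continuity is available here, so density of
  nice functions is not needed: the norms converge by scaling.
\<close>

lemma dilation_tendsto:
  fixes H :: "real \<Rightarrow> real" and s :: "nat \<Rightarrow> real"
  assumes p: "1 \<le> p" "p \<le> 2"
    and [measurable]: "H \<in> borel_measurable borel"
    and cont: "\<And>x. isCont (\<lambda>s. H (x * exp s)) 0"
    and H: "integrable lborel (\<lambda>x. \<bar>H x\<bar> ^ p)"
    and s: "s \<longlonglongrightarrow> 0"
  shows "(\<lambda>n. \<integral>x. \<bar>H (x * exp (s n)) - H x\<bar> ^ p \<partial>lborel) \<longlonglongrightarrow> 0"
\<comment> \<open>A single integrable function need not dominate all dilates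
  \<open>H (x * exp (s n))\<close>, so the majorant moves with \<open>n\<close>; its integral is
  known exactly by scaling.\<close>
proof (rule dominated_convergence_moving_bound
    [where v = "\<lambda>n x. 2 * \<bar>H (x * exp (s n))\<bar> ^ p + 2 * \<bar>H x\<bar> ^ p" and V = "\<lambda>x. 4 * \<bar>H x\<bar> ^ p"])
  note dil = integral_dilation[OF H]
  have lim: "(\<lambda>n. H (x * exp (s n))) \<longlonglongrightarrow> H x" for x
    using isCont_tendsto_compose[OF cont s, of x] by simp
  show "(\<lambda>n. \<bar>H (x * exp (s n)) - H x\<bar> ^ p) \<longlonglongrightarrow> 0" for x
    using tendsto_power[OF tendsto_rabs[OF tendsto_diff[OF lim[of x] tendsto_const[of "H x"]]], of p] p by (simp add: power_0_left)
  show "(\<lambda>n. 2 * \<bar>H (x * exp (s n))\<bar> ^ p + 2 * \<bar>H x\<bar> ^ p) \<longlonglongrightarrow> 4 * \<bar>H x\<bar> ^ p" for x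
    by (rule tendsto_eq_intros lim refl | simp)+
  have "(\<lambda>n. 2 * (exp (- s n) * (\<integral>x. \<bar>H x\<bar> ^ p \<partial>lborel)) + 2 * (\<integral>x. \<bar>H x\<bar> ^ p \<partial>lborel))
      \<longlonglongrightarrow> 4 * (\<integral>x. \<bar>H x\<bar> ^ p \<partial>lborel)"
    by (rule tendsto_eq_intros s refl | simp)+
  then show "(\<lambda>n. \<integral>x. 2 * \<bar>H (x * exp (s n))\<bar> ^ p + 2 * \<bar>H x\<bar> ^ p \<partial>lborel)
      \<longlonglongrightarrow> (\<integral>x. 4 * \<bar>H x\<bar> ^ p \<partial>lborel)"
    using dil H by simp
qed (use H integral_dilation[OF H] abs_diff_power_le[OF p] in auto)

text \<open>Crude for small \<open>s\<close>, but valid for all \<open>s\<close>: once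
  \<open>s\<close> becomes a random exponent, the factor \<open>exp \<bar>s\<bar>\<close> supplies
  the majorant in the noise variable.\<close>

lemma dilation_bound:
  fixes H :: "real \<Rightarrow> real"
  assumes p: "1 \<le> p" "p \<le> 2"
    and [measurable]: "H \<in> borel_measurable borel"
    and H: "integrable lborel (\<lambda>x. \<bar>H x\<bar> ^ p)"
  shows "integrable lborel (\<lambda>x. \<bar>H (x * exp s) - H x\<bar> ^ p)"
    and "(\<integral>x. \<bar>H (x * exp s) - H x\<bar> ^ p \<partial>lborel) \<le> 4 * exp \<bar>s\<bar> * (\<integral>x. \<bar>H x\<bar> ^ p \<partial>lborel)"
proof -
  note dil = integral_dilation[OF H, of s]
  let ?v = "\<lambda>x. 2 * \<bar>H (x * exp s)\<bar> ^ p + 2 * \<bar>H x\<bar> ^ p"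
  have v: "integrable lborel ?v"
    using dil H by auto
  show i: "integrable lborel (\<lambda>x. \<bar>H (x * exp s) - H x\<bar> ^ p)"
    by (rule Bochner_Integration.integrable_bound[OF v]) (auto simp: abs_diff_power_le[OF p])
  have "(\<integral>x. \<bar>H (x * exp s) - H x\<bar> ^ p \<partial>lborel) \<le> (\<integral>x. ?v x \<partial>lborel)"
    by (intro integral_mono i v abs_diff_power_le[OF p])
  also have "\<dots> = (2 * exp (- s) + 2) * (\<integral>x. \<bar>H x\<bar> ^ p \<partial>lborel)"
    using dil H by (simp add: algebra_simps)
  also have "\<dots> \<le> 4 * exp \<bar>s\<bar> * (\<integral>x. \<bar>H x\<bar> ^ p \<partial>lborel)"
  proof (rule mult_right_mono)
    show "2 * exp (- s) + 2 \<le> 4 * exp \<bar>s\<bar>"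
      using exp_le_cancel_iff[of "- s" "\<bar>s\<bar>"] one_le_exp_iff[of "\<bar>s\<bar>"] by linarith
  qed simp
  finally show "(\<integral>x. \<bar>H (x * exp s) - H x\<bar> ^ p \<partial>lborel) \<le> \<dots>" .
qed

text \<open>By Tonelli the integral over \<open>x\<close> may be taken first, which produces the L^p
  modulus of continuity \<open>\<omega>\<close>. It tends to 0 for each fixed \<open>y\<close>, and
  its growth is integrable against the weight. In the applications \<open>y = (z, t)\<close> is a
  Gaussian value with a Taylor parameter, and \<open>\<tau> y = t * z\<close>. Working in
  \<open>ennreal\<close> allows the exchange before any integrability is known.\<close>

lemma averaged_dilation_tendsto:
  fixes H :: "real \<Rightarrow> real" and \<sigma> :: "nat \<Rightarrow> real" and w \<tau> :: "'b \<Rightarrow> real"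
  assumes "sigma_finite_measure P"
    and p: "1 \<le> p" "p \<le> 2"
    and [measurable]: "H \<in> borel_measurable borel" "w \<in> borel_measurable P" "\<tau> \<in> borel_measurable P"
    and cont: "\<And>x. isCont (\<lambda>s. H (x * exp s)) 0"
    and H: "integrable lborel (\<lambda>x. \<bar>H x\<bar> ^ p)"
    and w: "\<And>y. 0 \<le> w y" "integrable P (\<lambda>y. w y * exp \<bar>\<tau> y\<bar>)"
    and \<sigma>: "\<sigma> \<longlonglongrightarrow> 0" "\<And>n. \<bar>\<sigma> n\<bar> \<le> 1"
  shows "(\<lambda>n. \<integral>\<^sup>+x. \<integral>\<^sup>+y. ennreal (w y * \<bar>H (x * exp (\<sigma> n * \<tau> y)) - H x\<bar> ^ p) \<partial>P \<partial>lborel) \<longlonglongrightarrow> 0"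
proof -
  interpret P: sigma_finite_measure P by fact
  interpret pair_sigma_finite P lborel ..
  define \<omega> where "\<omega> s = (\<integral>x. \<bar>H (x * exp s) - H x\<bar> ^ p \<partial>lborel)" for s
  have [measurable]: "\<omega> \<in> borel_measurable borel"
    unfolding \<omega>_def by measurable
  have \<omega>0: "0 \<le> \<omega> s" for s
    by (simp add: \<omega>_def)
  have swap: "(\<integral>\<^sup>+x. \<integral>\<^sup>+y. ennreal (w y * \<bar>H (x * exp (\<sigma> n * \<tau> y)) - H x\<bar> ^ p) \<partial>P \<partial>lborel)
      = (\<integral>\<^sup>+y. ennreal (w y * \<omega> (\<sigma> n * \<tau> y)) \<partial>P)" for n
  proof -
    have "(\<integral>\<^sup>+x. \<integral>\<^sup>+y. ennreal (w y * \<bar>H (x * exp (\<sigma> n * \<tau> y)) - H x\<bar> ^ p) \<partial>P \<partial>lborel)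
      = (\<integral>\<^sup>+y. \<integral>\<^sup>+x. ennreal (w y * \<bar>H (x * exp (\<sigma> n * \<tau> y)) - H x\<bar> ^ p) \<partial>lborel \<partial>P)"
      by (rule Fubini') measurable
    also have "\<dots> = (\<integral>\<^sup>+y. ennreal (w y * \<omega> (\<sigma> n * \<tau> y)) \<partial>P)"
    proof (rule nn_integral_cong)
      fix y
      show "(\<integral>\<^sup>+x. ennreal (w y * \<bar>H (x * exp (\<sigma> n * \<tau> y)) - H x\<bar> ^ p) \<partial>lborel)
          = ennreal (w y * \<omega> (\<sigma> n * \<tau> y))"
        using dilation_bound(1)[OF p _ H] w(1)
        by (subst nn_integral_eq_integral) (auto simp: \<omega>_def)
    qed
    finally show ?thesis .
  qed
  have "(\<lambda>n. \<integral>\<^sup>+y. ennreal (w y * \<omega> (\<sigma> n * \<tau> y)) \<partial>P) \<longlonglongrightarrow> (\<integral>\<^sup>+y. 0 \<partial>P)"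
  proof (rule nn_integral_dominated_convergence
      [where w = "\<lambda>y. ennreal (4 * (\<integral>x. \<bar>H x\<bar> ^ p \<partial>lborel) * (w y * exp \<bar>\<tau> y\<bar>))"])
    show "AE y in P. ennreal (w y * \<omega> (\<sigma> n * \<tau> y))
        \<le> ennreal (4 * (\<integral>x. \<bar>H x\<bar> ^ p \<partial>lborel) * (w y * exp \<bar>\<tau> y\<bar>))" for n
    proof (intro AE_I2 ennreal_leI)
      fix y
      have "\<omega> (\<sigma> n * \<tau> y) \<le> 4 * exp \<bar>\<sigma> n * \<tau> y\<bar> * (\<integral>x. \<bar>H x\<bar> ^ p \<partial>lborel)"
        unfolding \<omega>_def by (rule dilation_bound(2)[OF p _ H]) simp
      also have "\<dots> \<le> 4 * exp \<bar>\<tau> y\<bar> * (\<integral>x. \<bar>H x\<bar> ^ p \<partial>lborel)"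
        using \<sigma>(2)[of n] by (intro mult_right_mono mult_left_mono) (auto simp: abs_mult mult_left_le_one_le)
      finally show "w y * \<omega> (\<sigma> n * \<tau> y) \<le> 4 * (\<integral>x. \<bar>H x\<bar> ^ p \<partial>lborel) * (w y * exp \<bar>\<tau> y\<bar>)"
        using mult_left_mono[OF _ w(1)[of y]] by (fastforce simp: ac_simps)
    qed
    show "(\<integral>\<^sup>+y. ennreal (4 * (\<integral>x. \<bar>H x\<bar> ^ p \<partial>lborel) * (w y * exp \<bar>\<tau> y\<bar>)) \<partial>P) < \<infinity>"
      using w by (subst nn_integral_eq_integral) auto
    show "AE y in P. (\<lambda>n. ennreal (w y * \<omega> (\<sigma> n * \<tau> y))) \<longlonglongrightarrow> 0"
    proof (rule AE_I2)
      fix y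
      have "(\<lambda>n. \<sigma> n * \<tau> y) \<longlonglongrightarrow> 0"
        using tendsto_mult_left_zero[OF \<sigma>(1)] by simp
      then have "(\<lambda>n. \<omega> (\<sigma> n * \<tau> y)) \<longlonglongrightarrow> 0"
        unfolding \<omega>_def by (intro dilation_tendsto p cont H) simp
      then have "(\<lambda>n. ennreal (w y * \<omega> (\<sigma> n * \<tau> y))) \<longlonglongrightarrow> ennreal (w y * 0)"
        by (intro tendsto_intros)
      then show "(\<lambda>n. ennreal (w y * \<omega> (\<sigma> n * \<tau> y))) \<longlonglongrightarrow> 0"
        by simp
    qed
  qed auto
  then show ?thesis
    by (simp add: swap)
qed

text \<open>The integral of \<open>w y * (a - c * d y)\<^sup>2\<close> is a nonnegative quadratic
  form in \<open>a\<close> and \<open>c\<close>. Taking \<open>a = I\<close> and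
  \<open>c = W\<close> gives \<open>W\<close> times the claim, so \<open>W = 0\<close> has to be
  treated apart.\<close>

lemma weighted_Cauchy_Schwarz:
  fixes w d :: "'a \<Rightarrow> real"
  assumes w: "\<And>y. 0 \<le> w y" "integrable P w"
    and d: "integrable P (\<lambda>y. w y * d y)" "integrable P (\<lambda>y. w y * (d y)\<^sup>2)"
  shows "(\<integral>y. w y * d y \<partial>P)\<^sup>2 \<le> (\<integral>y. w y \<partial>P) * (\<integral>y. w y * (d y)\<^sup>2 \<partial>P)"
proof -
  define W I J where "W = (\<integral>y. w y \<partial>P)" and "I = (\<integral>y. w y * d y \<partial>P)" and "J = (\<integral>y. w y * (d y)\<^sup>2 \<partial>P)"
  have *: "0 \<le> a\<^sup>2 * W - 2 * a * c * I + c\<^sup>2 * J" for a c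
  proof -
    have "0 \<le> (\<integral>y. w y * (a - c * d y)\<^sup>2 \<partial>P)"
      using w by (intro integral_nonneg_AE) auto
    also have "(\<lambda>y. w y * (a - c * d y)\<^sup>2) = (\<lambda>y. a\<^sup>2 * w y - 2 * a * c * (w y * d y) + c\<^sup>2 * (w y * (d y)\<^sup>2))"
      by (auto simp: power2_eq_square algebra_simps)
    also have "(\<integral>y. a\<^sup>2 * w y - 2 * a * c * (w y * d y) + c\<^sup>2 * (w y * (d y)\<^sup>2) \<partial>P)
        = a\<^sup>2 * W - 2 * a * c * I + c\<^sup>2 * J"
      using w d by (simp add: W_def I_def J_def)
    finally show ?thesis .
  qed
  have "0 \<le> W" "0 \<le> J"
    using w by (auto simp: W_def J_def intro!: integral_nonneg_AE)
  show ?thesis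
  proof (cases "W = 0")
    case True
    have "I = 0"
    proof (rule ccontr)
      assume "I \<noteq> 0"
      then show False
        \<comment> \<open>With \<open>W = 0\<close> and \<open>c = 1\<close> the form is
          \<open>J - 2 * a * I\<close>, and this \<open>a\<close> makes it equal to -1.\<close>
        using *[of "(J + 1) / (2 * I)" 1] True by (simp add: field_simps)
    qed
    then show ?thesis
      using True by (simp add: W_def I_def)
  next
    case False
    then have "0 < W"
      using \<open>0 \<le> W\<close> by simp
    then have "I\<^sup>2 \<le> W * J"
      using *[of I W] by (simp add: power2_eq_square algebra_simps)
    then show ?thesis
      by (simp add: W_def I_def J_def)
  qed
qed

text \<open>Young's inequality bounds the difference of squares by \<open>(1 + 1 / \<epsilon>) * (a
  - c)\<^sup>2 + \<epsilon> * c\<^sup>2\<close>; the first part vanishes in the limit for fixed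
  \<open>\<epsilon>\<close>, the second is small through \<open>\<epsilon>\<close>.\<close>

lemma integral_power2_tendsto:
  fixes q :: "nat \<Rightarrow> 'a \<Rightarrow> real" and r :: "'a \<Rightarrow> real"
  assumes [measurable]: "\<And>n. q n \<in> borel_measurable M" "r \<in> borel_measurable M"
    and q: "\<And>n. integrable M (\<lambda>x. (q n x)\<^sup>2)" and r: "integrable M (\<lambda>x. (r x)\<^sup>2)"
    and lim: "(\<lambda>n. \<integral>x. (q n x - r x)\<^sup>2 \<partial>M) \<longlonglongrightarrow> 0"
  shows "(\<lambda>n. \<integral>x. (q n x)\<^sup>2 \<partial>M) \<longlonglongrightarrow> (\<integral>x. (r x)\<^sup>2 \<partial>M)"
proof (rule LIMSEQ_I)
  fix e :: real assume "0 < e"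
  define R where "R = (\<integral>x. (r x)\<^sup>2 \<partial>M)"
  \<comment> \<open>Chosen to make \<open>\<epsilon> * R < e / 2\<close>; the summand 1 covers
    \<open>R = 0\<close>.\<close>
  define \<epsilon> where "\<epsilon> = e / (2 * (R + 1))"
  have "0 \<le> R"
    by (simp add: R_def)
  then have \<epsilon>: "0 < \<epsilon>" "\<epsilon> * R < e / 2"
    using \<open>0 < e\<close> by (auto simp: \<epsilon>_def field_simps)
  have d: "integrable M (\<lambda>x. (q n x - r x)\<^sup>2)" for n
  proof (rule Bochner_Integration.integrable_bound)
    show "integrable M (\<lambda>x. 2 * (q n x)\<^sup>2 + 2 * (r x)\<^sup>2)"
      using q r by simp
    show "AE x in M. norm ((q n x - r x)\<^sup>2) \<le> norm (2 * (q n x)\<^sup>2 + 2 * (r x)\<^sup>2)"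
      using abs_diff_power_le[of 2] by auto
  qed simp
  have pt: "\<bar>a\<^sup>2 - c\<^sup>2\<bar> \<le> (1 + 1 / \<epsilon>) * (a - c)\<^sup>2 + \<epsilon> * c\<^sup>2" for a c :: real
  proof -
    have "0 \<le> ((a - c) - \<epsilon> * c)\<^sup>2" "0 \<le> ((a - c) + \<epsilon> * c)\<^sup>2"
      by auto
    then have "\<epsilon> * \<bar>2 * c * (a - c)\<bar> \<le> (a - c)\<^sup>2 + \<epsilon>\<^sup>2 * c\<^sup>2"
      unfolding power2_sum power2_diff[of "a - c"] power_mult_distrib
      by (cases "0 \<le> 2 * c * (a - c)") (simp_all add: algebra_simps)
    then have "\<bar>2 * c * (a - c)\<bar> \<le> (a - c)\<^sup>2 / \<epsilon> + \<epsilon> * c\<^sup>2"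
      using \<epsilon>(1) by (simp add: field_simps power2_eq_square)
    moreover have "a\<^sup>2 - c\<^sup>2 = (a - c)\<^sup>2 + 2 * c * (a - c)"
      by (simp add: power2_eq_square algebra_simps)
    moreover have "(1 + 1 / \<epsilon>) * (a - c)\<^sup>2 = (a - c)\<^sup>2 + (a - c)\<^sup>2 / \<epsilon>"
      by (simp add: algebra_simps)
    ultimately show ?thesis
      using zero_le_power2[of "a - c"] by linarith
  qed
  have "(\<lambda>n. (1 + 1 / \<epsilon>) * (\<integral>x. (q n x - r x)\<^sup>2 \<partial>M)) \<longlonglongrightarrow> 0"
    using tendsto_mult_right_zero[OF lim] by simp
  then obtain N where N: "\<And>n. n \<ge> N \<Longrightarrow> (1 + 1 / \<epsilon>) * (\<integral>x. (q n x - r x)\<^sup>2 \<partial>M) < e / 2"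
    using \<open>0 < e\<close> order_tendstoD(2)[of _ 0 sequentially "e/2"] by (auto simp: eventually_sequentially)
  show "\<exists>N. \<forall>n\<ge>N. norm ((\<integral>x. (q n x)\<^sup>2 \<partial>M) - (\<integral>x. (r x)\<^sup>2 \<partial>M)) < e"
  proof (intro exI allI impI)
    fix n assume "N \<le> n"
    have "norm ((\<integral>x. (q n x)\<^sup>2 \<partial>M) - (\<integral>x. (r x)\<^sup>2 \<partial>M)) = \<bar>\<integral>x. (q n x)\<^sup>2 - (r x)\<^sup>2 \<partial>M\<bar>"
      using q r by simp
    also have "\<dots> \<le> (\<integral>x. \<bar>(q n x)\<^sup>2 - (r x)\<^sup>2\<bar> \<partial>M)"
      by (rule integral_abs_bound)
    also have "\<dots> \<le> (\<integral>x. (1 + 1 / \<epsilon>) * (q n x - r x)\<^sup>2 + \<epsilon> * (r x)\<^sup>2 \<partial>M)"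
      using q r d pt by (intro integral_mono) auto
    also have "\<dots> = (1 + 1 / \<epsilon>) * (\<integral>x. (q n x - r x)\<^sup>2 \<partial>M) + \<epsilon> * R"
      using d r by (simp add: R_def)
    also have "\<dots> < e"
      using N[OF \<open>N \<le> n\<close>] \<epsilon>(2) by linarith
    finally show "norm ((\<integral>x. (q n x)\<^sup>2 \<partial>M) - (\<integral>x. (r x)\<^sup>2 \<partial>M)) < e" .
  qed
qed

section \<open>Gaussian exponential moments and the minimum of two Gaussians\<close>

abbreviation "std_normal_pair \<equiv> std_normal_distribution \<Otimes>\<^sub>M std_normal_distribution"

lemma prob_space_std_normal: "prob_space std_normal_distribution"
  using real_dist_normal_dist by (rule real_distribution.axioms)

lemma pair_prob_space_std_normal:
  "pair_prob_space std_normal_distribution std_normal_distribution"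
  by (intro pair_prob_space.intro pair_sigma_finite.intro prob_space_imp_sigma_finite prob_space_std_normal)

lemma prob_space_std_normal_pair: "prob_space std_normal_pair"
  
proof -
  interpret pair_prob_space std_normal_distribution std_normal_distribution
    by (rule pair_prob_space_std_normal)
  show ?thesis
    by (rule P.prob_space_axioms)
qed

text \<open>Completing the square turns the tilted density into a multiple of the normal density
  with mean \<open>c\<close>.\<close>

lemma integrable_std_normal_exp: "integrable std_normal_distribution (\<lambda>z. exp (c * z))"
proof -
  have "std_normal_density z * exp (c * z) = exp (c\<^sup>2 / 2) * normal_density c 1 z" for z
    by (simp add: normal_density_def exp_add[symmetric] exp_diff[symmetric] power2_eq_square field_simps)
  then have "integrable lborel (\<lambda>z. std_normal_density z * exp (c * z))"
    by simp
  then show ?thesis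
    by (subst integrable_real_density) auto
qed

lemma integrable_std_normal_exp_abs: "integrable std_normal_distribution (\<lambda>z. exp (c * \<bar>z\<bar>))"
proof (rule Bochner_Integration.integrable_bound)
  show "integrable std_normal_distribution (\<lambda>z. exp (c * z) + exp (- c * z))"
    by (intro Bochner_Integration.integrable_add integrable_std_normal_exp)
  show "AE z in std_normal_distribution. norm (exp (c * \<bar>z\<bar>)) \<le> norm (exp (c * z) + exp (- c * z))"
  proof (rule AE_I2)
    show "norm (exp (c * \<bar>z\<bar>)) \<le> norm (exp (c * z) + exp (- c * z))" for z :: real
      using exp_gt_zero[of "c * z"] exp_gt_zero[of "- c * z"] by (cases "0 \<le> z") (simp_all add: abs_if del: exp_gt_zero)
  qed
qed simp

text \<open>A single term of the exponential series. It absorbs polynomial factors in the Gaussian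
  variable into the exponential majorants.\<close>

lemma power_le_exp_abs: "\<bar>z\<bar> ^ k \<le> fact k * exp \<bar>z\<bar>" for z :: real
proof -
  have "\<bar>z\<bar> ^ k /\<^sub>R fact k \<le> exp \<bar>z\<bar>"
    using sum_le_suminf[OF summable_exp_generic[of "\<bar>z\<bar>"], of "{k}"] by (simp add: exp_def)
  then show ?thesis
    by (simp add: field_simps)
qed

lemma integrable_std_normal_power_exp:
  "integrable std_normal_distribution (\<lambda>z. \<bar>z\<bar> ^ k * exp (c * \<bar>z\<bar>))"
proof (rule Bochner_Integration.integrable_bound)
  show "integrable std_normal_distribution (\<lambda>z. fact k * exp ((1 + c) * \<bar>z\<bar>))"
    by (intro integrable_mult_right integrable_std_normal_exp_abs)
  show "AE z in std_normal_distribution. norm (\<bar>z\<bar> ^ k * exp (c * \<bar>z\<bar>)) \<le> norm (fact k * exp ((1 + c) * \<bar>z\<bar>))"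
    using power_le_exp_abs[of _ k]
    by (auto simp: distrib_right exp_add mult.assoc[symmetric] intro!: mult_right_mono)
qed simp

lemma (in pair_sigma_finite) integrable_product:
  fixes u v :: "_ \<Rightarrow> real"
  assumes "integrable M1 u" "integrable M2 v"
  shows "integrable (M1 \<Otimes>\<^sub>M M2) (\<lambda>p. u (fst p) * v (snd p))"
  by (rule Fubini_integrable) (use assms in \<open>auto simp: abs_mult\<close>)

lemmas integrable_std_normal_pair_prod =
  pair_sigma_finite.integrable_product[OF pair_prob_space.axioms(1)[OF pair_prob_space_std_normal]]

text \<open>A majorant of the difference quotient at 0 that is free of \<open>s\<close>, as required
  for differentiating an exponential moment under the integral.\<close>

lemma exp_minus_one_bound:
  fixes s m :: real
  assumes "0 < s" "s \<le> 1"
  shows "\<bar>(exp (s * m) - 1) / s\<bar> \<le> exp (2 * \<bar>m\<bar>)"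
proof -
  have "\<bar>exp y - 1\<bar> \<le> \<bar>y\<bar> * exp \<bar>y\<bar>" for y :: real
  proof (cases "0 \<le> y")
    case True
    have "exp y * (1 - y) \<le> exp y * exp (- y)"
      using exp_ge_add_one_self[of "- y"] by (intro mult_left_mono) auto
    then show ?thesis
      using True by (simp add: exp_minus algebra_simps)
  next
    case False
    then have "exp y < 1" "\<bar>y\<bar> = - y"
      by auto
    then have "\<bar>exp y - 1\<bar> \<le> \<bar>y\<bar> * 1"
      using exp_ge_add_one_self[of y] by linarith
    also have "\<dots> \<le> \<bar>y\<bar> * exp \<bar>y\<bar>"
      by (intro mult_left_mono) auto
    finally show ?thesis .
  qed
  from this[of "s * m"] have "\<bar>(exp (s * m) - 1) / s\<bar> \<le> \<bar>m\<bar> * exp \<bar>s * m\<bar>"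
    using assms by (simp add: abs_mult field_simps)
  also have "\<dots> \<le> exp \<bar>m\<bar> * exp \<bar>m\<bar>"
    using assms power_le_exp_abs[of m 1] by (intro mult_mono) (auto simp: abs_mult mult_left_le_one_le)
  finally show ?thesis
    by (simp add: exp_add[symmetric])
qed

text \<open>The minimum is half of the sum minus half of the absolute difference. The sum has mean
  0; the difference is normal with variance 2, and its mean absolute value is
  \<open>sqrt 2 * sqrt (2 / pi) = 2 / sqrt pi\<close>.\<close>

lemma integral_std_normal_pair_min:
  "(\<integral>p. min (fst p) (snd p) \<partial>std_normal_pair) = - 1 / sqrt pi"
proof -
  interpret N: prob_space std_normal_distribution
    by (rule prob_space_std_normal)
  interpret P: pair_prob_space std_normal_distribution std_normal_distribution
    by (rule pair_prob_space_std_normal)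
  have snd: "distr std_normal_pair std_normal_distribution snd = std_normal_distribution"
    by (subst P.distr_pair_swap) (simp add: distr_distr comp_def case_prod_unfold N.distr_pair_fst)
  have fst: "distr std_normal_pair std_normal_distribution fst = std_normal_distribution"
    by (rule N.distr_pair_fst)
  have fst': "distr std_normal_pair borel fst = std_normal_distribution"
    using fst by (simp cong: distr_cong)
  have snd': "distr std_normal_pair borel snd = std_normal_distribution"
    using snd by (simp cong: distr_cong)
  have d: "distributed std_normal_pair lborel fst std_normal_density"
      "distributed std_normal_pair lborel snd std_normal_density"
    using fst snd by (auto simp: distributed_def cong: distr_cong)
  \<comment> \<open>The joint law of the two coordinates is the image of the product measure under
    the identity, hence the product of the marginals.\<close>
  have "P.indep_var borel fst borel snd"
    unfolding P.indep_var_distribution_eq fst' snd'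
    by (auto intro!: measure_eqI simp: emeasure_distr)
  from P.diff_indep_normal[OF this _ _ d]
  have D: "distributed std_normal_pair lborel (\<lambda>p. fst p - snd p) (normal_density 0 (sqrt 2))"
    by simp
  have m: "has_bochner_integral lborel (\<lambda>x. normal_density 0 (sqrt 2) x * \<bar>x\<bar>) (sqrt 2 * sqrt (2 / pi))"
    using normal_moment_abs_odd[of "sqrt 2" 0 0] by simp
  have abs: "(\<integral>p. \<bar>fst p - snd p\<bar> \<partial>std_normal_pair) = 2 / sqrt pi"
    using distributed_integral[OF D, of abs] m by (simp add: has_bochner_integral_iff real_sqrt_divide)
  have i: "integrable std_normal_distribution (\<lambda>z. z)"
    using integrable_std_normal_distribution_moment[of 1] by simp
  have i1: "integrable std_normal_pair fst" "integrable std_normal_pair snd"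
    using integrable_std_normal_pair_prod[OF i, of "\<lambda>_. 1"] integrable_std_normal_pair_prod[OF _ i, of "\<lambda>_. 1"] by simp_all
  have "(\<integral>z. z \<partial>std_normal_distribution) = 0"
    using integral_std_normal_distribution_moment_odd[of 1] by simp
  then have z: "(\<integral>p. fst p \<partial>std_normal_pair) = 0" "(\<integral>p. snd p \<partial>std_normal_pair) = 0"
    using integral_distr[of fst std_normal_pair std_normal_distribution "\<lambda>z. z"]
      integral_distr[of snd std_normal_pair std_normal_distribution "\<lambda>z. z"] fst snd by simp_all
  have "(\<integral>p. min (fst p) (snd p) \<partial>std_normal_pair)
      = (\<integral>p. (fst p + snd p - \<bar>fst p - snd p\<bar>) / 2 \<partial>std_normal_pair)"
    by (intro Bochner_Integration.integral_cong) (auto simp: min_def)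
  also have "\<dots> = - 1 / sqrt pi"
    using i1 z abs by simp
  finally show ?thesis .
qed

lemma integrable_std_normal_pair_exp_min:
  "integrable std_normal_pair (\<lambda>p. exp (c * min (fst p) (snd p)))"
  "integrable std_normal_pair (\<lambda>p. exp (c * \<bar>min (fst p) (snd p)\<bar>))"
proof -
  have *: "integrable std_normal_pair (\<lambda>p. exp (\<bar>c\<bar> * \<bar>fst p\<bar>) * exp (\<bar>c\<bar> * \<bar>snd p\<bar>))"
    by (intro integrable_std_normal_pair_prod integrable_std_normal_exp_abs)
  have b: "\<bar>c * min x y\<bar> \<le> \<bar>c\<bar> * \<bar>x\<bar> + \<bar>c\<bar> * \<bar>y\<bar>" for x y
    by (auto simp: min_def abs_mult)
  show "integrable std_normal_pair (\<lambda>p. exp (c * min (fst p) (snd p)))"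
    by (rule Bochner_Integration.integrable_bound[OF *])
      (auto simp: exp_add[symmetric] intro: order_trans[OF abs_ge_self b])
  show "integrable std_normal_pair (\<lambda>p. exp (c * \<bar>min (fst p) (snd p)\<bar>))"
    by (rule Bochner_Integration.integrable_bound[OF *])
      (auto simp: exp_add[symmetric] intro!: order_trans[OF _ b] simp: abs_mult mult_right_mono)
qed

text \<open>The derivative at 0 of the exponential moment of minus the minimum, which is minus the
  mean of the minimum. This limit is the source of the factor \<open>1 / sqrt pi\<close> in the
  variance term.\<close>

lemma exp_min_derivative:
  assumes \<sigma>: "\<sigma> \<longlonglongrightarrow> 0" "\<And>n. 0 < \<sigma> n" "\<And>n. \<sigma> n \<le> 1"
  shows "(\<lambda>n. ((\<integral>p. exp (- (\<sigma> n * min (fst p) (snd p))) \<partial>std_normal_pair) - 1) / \<sigma> n) \<longlonglongrightarrow> 1 / sqrt pi"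
proof -
  interpret P: prob_space std_normal_pair
    by (rule prob_space_std_normal_pair)
  define m :: "real \<times> real \<Rightarrow> real" where "m p = min (fst p) (snd p)" for p
  have [measurable]: "m \<in> borel_measurable std_normal_pair"
    unfolding m_def by measurable
  have "(\<lambda>n. \<integral>p. (exp (\<sigma> n * - m p) - 1) / \<sigma> n \<partial>std_normal_pair) \<longlonglongrightarrow> (\<integral>p. - m p \<partial>std_normal_pair)"
  proof (rule integral_dominated_convergence)
    show "integrable std_normal_pair (\<lambda>p. exp (2 * \<bar>m p\<bar>))"
      unfolding m_def by (rule integrable_std_normal_pair_exp_min)
    show "AE p in std_normal_pair. norm ((exp (\<sigma> n * - m p) - 1) / \<sigma> n) \<le> exp (2 * \<bar>m p\<bar>)" for n
      using exp_minus_one_bound[OF \<sigma>(2,3), of n "- m _"] by (intro AE_I2) (simp only: real_norm_def abs_minus_cancel)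
    show "AE p in std_normal_pair. (\<lambda>n. (exp (\<sigma> n * - m p) - 1) / \<sigma> n) \<longlonglongrightarrow> - m p"
    proof (rule AE_I2)
      fix p
      have "((\<lambda>s. exp (s * - m p)) has_real_derivative - m p) (at 0)"
        by (auto intro!: derivative_eq_intros)
      then have "((\<lambda>s. (exp (s * - m p) - 1) / s) \<longlongrightarrow> - m p) (at 0)"
        by (simp add: has_field_derivative_iff)
      moreover have "filterlim \<sigma> (at 0) sequentially"
        using \<sigma> by (auto simp: filterlim_at intro!: always_eventually less_imp_neq[THEN not_sym])
      ultimately show "(\<lambda>n. (exp (\<sigma> n * - m p) - 1) / \<sigma> n) \<longlonglongrightarrow> - m p"
        by (rule filterlim_compose)
    qed
  qed auto
  moreover have "(\<integral>p. - m p \<partial>std_normal_pair) = 1 / sqrt pi"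
    using integral_std_normal_pair_min by (simp add: m_def)
  moreover have "(\<integral>p. (exp (\<sigma> n * - m p) - 1) / \<sigma> n \<partial>std_normal_pair)
      = ((\<integral>p. exp (- (\<sigma> n * m p)) \<partial>std_normal_pair) - 1) / \<sigma> n" for n
  proof -
    have "integrable std_normal_pair (\<lambda>p. exp (- (\<sigma> n * m p)))"
      using integrable_std_normal_pair_exp_min(1)[of "- \<sigma> n"] by (simp add: m_def)
    then show ?thesis
      by (simp add: P.prob_space del: integral_divide_zero integral_divide)
  qed
  ultimately have "(\<lambda>n. ((\<integral>p. exp (- (\<sigma> n * m p)) \<partial>std_normal_pair) - 1) / \<sigma> n) \<longlonglongrightarrow> 1 / sqrt pi"
    by (simp only:)
  then show ?thesis
    by (simp only: m_def)
qed

section \<open>The uniform law of the Taylor parameter\<close>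

text \<open>The uniform law on the unit interval, so that an integral remainder is an average which
  can be merged with the Gaussian one. As a density on the whole line it keeps the space
  \<open>UNIV\<close> and the Borel sets, so measurability is that of functions on the line.\<close>

definition unit_interval_measure :: "real measure" where
  "unit_interval_measure = density lborel (\<lambda>t. ennreal (indicator {0..1} t))"

lemma sets_unit_interval_measure [measurable_cong, simp]: "sets unit_interval_measure = sets borel"
  by (simp add: unit_interval_measure_def)

lemma space_unit_interval_measure [simp]: "space unit_interval_measure = UNIV"
  by (simp add: unit_interval_measure_def)

lemma prob_space_unit_interval_measure: "prob_space unit_interval_measure"
  by (rule prob_spaceI) (simp add: unit_interval_measure_def emeasure_density ennreal_indicator)

lemma AE_unit_interval_measure: "AE t in unit_interval_measure. 0 \<le> t \<and> t \<le> 1"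
  unfolding unit_interval_measure_def by (subst AE_density) (auto simp: indicator_def)

lemma integral_unit_interval_FTC:
  fixes \<phi> \<Phi> :: "real \<Rightarrow> real"
  assumes "\<And>t. (\<Phi> has_real_derivative \<phi> t) (at t)" "\<And>t. isCont \<phi> t"
  shows "(\<integral>t. \<phi> t \<partial>unit_interval_measure) = \<Phi> 1 - \<Phi> 0"
proof -
  have [measurable]: "\<phi> \<in> borel_measurable borel"
    using assms(2) by (intro borel_measurable_continuous_onI continuous_at_imp_continuous_on) auto
  have "(\<integral>t. \<phi> t \<partial>unit_interval_measure) = (\<integral>t. \<phi> t * indicator {0..1} t \<partial>lborel)"
    unfolding unit_interval_measure_def by (subst integral_real_density) (auto simp: mult.commute)
  also have "\<dots> = \<Phi> 1 - \<Phi> 0"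
    using assms by (intro integral_FTC_Icc_real) (auto intro: has_field_derivative_at_within)
  finally show ?thesis .
qed

text \<open>The absolute value changes nothing on the unit interval; it makes the Taylor weight
  nonnegative at every point, the form in which \<open>averaged_dilation_tendsto\<close> and
  \<open>weighted_Cauchy_Schwarz\<close> take their weights.\<close>

lemma integral_unit_interval_abs_one_minus: "(\<integral>t. \<bar>1 - t\<bar> \<partial>unit_interval_measure) = 1 / 2"
proof -
  have "((\<lambda>t. t - t\<^sup>2 / 2) has_real_derivative 1 - t) (at t)" for t :: real
    by (auto intro!: derivative_eq_intros)
  from integral_unit_interval_FTC[OF this] have "(\<integral>t. 1 - t \<partial>unit_interval_measure) = 1 / 2"
    by simp
  moreover have "(\<integral>t. \<bar>1 - t\<bar> \<partial>unit_interval_measure) = (\<integral>t. 1 - t \<partial>unit_interval_measure)"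
    by (intro integral_cong_AE eventually_mono[OF AE_unit_interval_measure]) auto
  ultimately show ?thesis
    by simp
qed

abbreviation "std_normal_unit \<equiv> std_normal_distribution \<Otimes>\<^sub>M unit_interval_measure"

lemma pair_prob_space_std_normal_unit: "pair_prob_space std_normal_distribution unit_interval_measure"
  by (intro pair_prob_space.intro pair_sigma_finite.intro prob_space_imp_sigma_finite
      prob_space_std_normal prob_space_unit_interval_measure)

lemma AE_std_normal_unit: "AE p in std_normal_unit. 0 \<le> snd p \<and> snd p \<le> 1"
proof -
  interpret pair_prob_space std_normal_distribution unit_interval_measure
    by (rule pair_prob_space_std_normal_unit)
  show ?thesis
  proof (rule AE_pair_measure)
    show "{p \<in> space std_normal_unit. 0 \<le> snd p \<and> snd p \<le> 1} \<in> sets std_normal_unit"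
      by measurable
  qed (use AE_unit_interval_measure in auto)
qed

text \<open>Since \<open>t\<close> has total mass 1, a majorant in \<open>z\<close> alone suffices.
  The second part links Taylor's formula, an integral over \<open>t\<close> for each
  \<open>z\<close>, with one joint average over both variables.\<close>

lemma integrable_std_normal_unit:
  fixes \<phi> :: "real \<times> real \<Rightarrow> real"
  assumes [measurable]: "\<phi> \<in> borel_measurable (borel \<Otimes>\<^sub>M borel)"
    and B: "integrable std_normal_distribution B"
    and bound: "\<And>z t. 0 \<le> t \<Longrightarrow> t \<le> 1 \<Longrightarrow> \<bar>\<phi> (z, t)\<bar> \<le> B z"
  shows "integrable std_normal_unit \<phi>"
    and "(\<integral>p. \<phi> p \<partial>std_normal_unit) = (\<integral>z. \<integral>t. \<phi> (z, t) \<partial>unit_interval_measure \<partial>std_normal_distribution)"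
proof -
  interpret pair_prob_space std_normal_distribution unit_interval_measure
    by (rule pair_prob_space_std_normal_unit)
  show i: "integrable std_normal_unit \<phi>"
  proof (rule Bochner_Integration.integrable_bound)
    show "integrable std_normal_unit (\<lambda>p. B (fst p) * 1)"
      by (intro integrable_product B) simp
    show "AE p in std_normal_unit. norm (\<phi> p) \<le> norm (B (fst p) * 1)"
      using AE_std_normal_unit
    proof eventually_elim
      case (elim p)
      then show ?case
        using bound[of "snd p" "fst p"] by simp
    qed
  qed measurable
  then show "(\<integral>p. \<phi> p \<partial>std_normal_unit) = (\<integral>z. \<integral>t. \<phi> (z, t) \<partial>unit_interval_measure \<partial>std_normal_distribution)"
    by (rule integral_fst'[symmetric])
qed

lemma abs_dilation_exponent_le:
  fixes \<sigma> z t :: real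
  assumes "0 < \<sigma>" "\<sigma> \<le> 1" "0 \<le> t" "t \<le> 1"
  shows "\<bar>\<sigma> * (t * z)\<bar> \<le> \<bar>z\<bar>"
proof -
  have "\<bar>\<sigma> * (t * z)\<bar> = (\<sigma> * t) * \<bar>z\<bar>"
    using assms by (simp add: abs_mult)
  also have "\<dots> \<le> 1 * \<bar>z\<bar>"
    using assms by (intro mult_right_mono mult_le_one) auto
  finally show ?thesis by simp
qed

lemma integral_std_normal_id: "integrable std_normal_distribution (\<lambda>z. z)" "(\<integral>z. z \<partial>std_normal_distribution) = 0"
  using integrable_std_normal_distribution_moment[of 1] integral_std_normal_distribution_moment_odd[of 1]
  by simp_all

lemma integral_std_normal_power2:
  "integrable std_normal_distribution (\<lambda>z. z\<^sup>2)" "(\<integral>z. z\<^sup>2 \<partial>std_normal_distribution) = 1"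
  using integrable_std_normal_distribution_moment[of 2] std_normal_distribution_even_moments(1)[of 1]
  by simp_all

text \<open>The mass \<open>E Z\<^sup>2 / 2\<close> of the second-order remainder weight, which is
  the first factor in the Cauchy-Schwarz bound of the bias.\<close>

lemma integral_Taylor_weight:
  "integrable std_normal_unit (\<lambda>p. (fst p)\<^sup>2 * \<bar>1 - snd p\<bar>)"
  "(\<integral>p. (fst p)\<^sup>2 * \<bar>1 - snd p\<bar> \<partial>std_normal_unit) = 1 / 2"
proof -
  note PU = integrable_std_normal_unit[of "\<lambda>p. (fst p)\<^sup>2 * \<bar>1 - snd p\<bar>", OF _ integral_std_normal_power2(1)]
  have b: "\<bar>(fst (z, t))\<^sup>2 * \<bar>1 - snd (z, t)\<bar>\<bar> \<le> z\<^sup>2" if "0 \<le> t" "t \<le> 1" for z t :: real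
    using that by (simp add: abs_mult mult_right_le_one_le)
  show "integrable std_normal_unit (\<lambda>p. (fst p)\<^sup>2 * \<bar>1 - snd p\<bar>)"
    by (rule PU(1)) (use b in auto)
  have "(\<integral>p. (fst p)\<^sup>2 * \<bar>1 - snd p\<bar> \<partial>std_normal_unit)
      = (\<integral>z. \<integral>t. (fst (z, t))\<^sup>2 * \<bar>1 - snd (z, t)\<bar> \<partial>unit_interval_measure \<partial>std_normal_distribution)"
    by (rule PU(2)) (use b in auto)
  also have "\<dots> = 1 / 2"
    by (simp add: integral_unit_interval_abs_one_minus integral_std_normal_power2)
  finally show "(\<integral>p. (fst p)\<^sup>2 * \<bar>1 - snd p\<bar> \<partial>std_normal_unit) = 1 / 2" .
qed

lemma ennreal_tendsto_0_bound:
  fixes u :: "nat \<Rightarrow> real" and v :: "nat \<Rightarrow> ennreal"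
  assumes "\<And>n. 0 \<le> u n" "\<And>n. ennreal (u n) \<le> v n" "v \<longlonglongrightarrow> 0"
  shows "u \<longlonglongrightarrow> 0"
proof -
  have "(\<lambda>n. ennreal (u n)) \<longlonglongrightarrow> ennreal 0"
  proof (rule tendsto_sandwich[OF _ _ tendsto_const])
    show "\<forall>\<^sub>F n in sequentially. ennreal (u n) \<le> v n"
      using assms(2) by simp
    show "v \<longlonglongrightarrow> ennreal 0"
      using assms(3) by simp
  qed simp
  then show ?thesis
    using tendsto_ennreal_iff[of u sequentially 0] assms(1) by simp
qed

section \<open>Averages of a c.d.f. over random dilations\<close>

text \<open>
  With \<open>g x = x f x\<close> and \<open>h x = x (f x + x f' x)\<close> on the positive half-line and \<open>0\<close> elsewhere,
  \<open>g\<close> and \<open>h\<close> are the first two derivatives of \<open>F\<close> along the dilation flow \<open>s \<mapsto> x e\<^sup>s\<close>.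
\<close>

locale dilation_smooth_cdf =
  fixes F g h :: "real \<Rightarrow> real" and K :: real
  assumes F_mono: "mono F"
    and F_nonneg: "0 \<le> F x" and F_le_1: "F x \<le> 1"
    and F_nonpos: "x \<le> 0 \<Longrightarrow> F x = 0"
    and F_deriv: "((\<lambda>s. F (x * exp s)) has_real_derivative g (x * exp s)) (at s)"
    and g_deriv: "((\<lambda>s. g (x * exp s)) has_real_derivative h (x * exp s)) (at s)"
    and h_cont: "isCont (\<lambda>s. h (x * exp s)) s"
    and g_measurable [measurable]: "g \<in> borel_measurable borel"
    and h_measurable [measurable]: "h \<in> borel_measurable borel"
    and g_integrable: "integrable lborel g"
    and h_integrable: "integrable lborel (\<lambda>x. (h x)\<^sup>2)"
    and g_bound: "\<bar>g x\<bar> \<le> K * \<bar>x\<bar>"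
    and h_bound: "\<bar>h x\<bar> \<le> K * (\<bar>x\<bar> + x\<^sup>2)"
    and survival_integral:
      "has_bochner_integral lborel (\<lambda>x. indicator {0<..} x * (1 - F x)) (\<integral>x. g x \<partial>lborel)"
begin

lemma F_measurable [measurable]: "F \<in> borel_measurable borel"
  using F_mono by (rule borel_measurable_mono)

lemma K_nonneg: "0 \<le> K"
  using g_bound[of 1] by simp

text \<open>If \<open>F\<close> is the c.d.f. of some variable independent of \<open>Y\<close>, this
  is the c.d.f. of that variable times \<open>exp (- Y)\<close>. The space \<open>P\<close> is
  arbitrary because the mean of the kernel calls for one Gaussian and its second moment for
  two.\<close>

definition smooth :: "'b measure \<Rightarrow> ('b \<Rightarrow> real) \<Rightarrow> real \<Rightarrow> real" where
  "smooth P Y x = (\<integral>y. F (x * exp (Y y)) \<partial>P)"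

text \<open>By \<open>survival_integral\<close> this is also the integral of \<open>1 - F\<close>
  over the positive half-line, the first moment.\<close>

definition mean :: real where
  "mean = (\<integral>x. g x \<partial>lborel)"

lemma smooth_measurable [measurable]:
  assumes "prob_space P" and [measurable]: "Y \<in> borel_measurable P"
  shows "smooth P Y \<in> borel_measurable borel"
proof -
  interpret prob_space P by fact
  show ?thesis
    unfolding smooth_def by measurable
qed

lemma integrable_F:
  assumes "prob_space P" and [measurable]: "Y \<in> borel_measurable P"
  shows "integrable P (\<lambda>y. F (x * exp (Y y)))"
proof -
  interpret prob_space P by fact
  show ?thesis
    by (rule integrable_const_bound[where B = 1]) (auto simp: F_nonneg F_le_1)
qed

lemma smooth_bounds:
  assumes "prob_space P" and [measurable]: "Y \<in> borel_measurable P"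
  shows "0 \<le> smooth P Y x" "smooth P Y x \<le> 1"
proof -
  interpret prob_space P by fact
  show "0 \<le> smooth P Y x"
    unfolding smooth_def by (simp add: F_nonneg)
  have "smooth P Y x \<le> (\<integral>y. 1 \<partial>P)"
    unfolding smooth_def using assms by (intro integral_mono integrable_F) (auto simp: F_le_1)
  then show "smooth P Y x \<le> 1"
    by (simp add: prob_space)
qed

lemma smooth_nonpos: "x \<le> 0 \<Longrightarrow> smooth P Y x = 0"
  by (simp add: smooth_def F_nonpos mult_nonpos_nonneg)

text \<open>The first moment of a product of independent variables, written with survival functions:
  after the exchange of integrals, rescaling \<open>x\<close> turns each value of \<open>Y\<close>
  into the factor \<open>exp (- Y y)\<close>. No expansion is involved, so the identity is
  exact.\<close>

lemma smooth_survival: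
  assumes "prob_space P" and [measurable]: "Y \<in> borel_measurable P"
    and Y: "integrable P (\<lambda>y. exp (- Y y))"
  shows "has_bochner_integral lborel (\<lambda>x. indicator {0<..} x * (1 - smooth P Y x))
           (mean * (\<integral>y. exp (- Y y) \<partial>P))"
proof (rule has_bochner_integral_nn_integral)
  interpret P: prob_space P by fact
  interpret pair_sigma_finite P lborel ..
  show "(\<lambda>x. indicator {0<..} x * (1 - smooth P Y x)) \<in> borel_measurable lborel"
    using assms by simp
  show "AE x in lborel. 0 \<le> indicator {0<..} x * (1 - smooth P Y x)"
    using smooth_bounds[OF assms(1,2)] by auto
  have "0 \<le> mean"
    unfolding mean_def using survival_integral
    by (simp add: has_bochner_integral_iff F_le_1 flip: has_bochner_integral_integral_eq[OF survival_integral])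
  then show "0 \<le> mean * (\<integral>y. exp (- Y y) \<partial>P)"
    by simp
  define W where "W x = indicator {0<..} x * (1 - F x)" for x :: real
  have [measurable]: "W \<in> borel_measurable borel"
    unfolding W_def by measurable
  have W0: "0 \<le> W x" for x
    by (simp add: W_def F_le_1)
  have W_exp: "W (x * exp s) = indicator {0<..} x * (1 - F (x * exp s))" for x s
    by (auto simp: W_def indicator_def zero_less_mult_iff)
  have "(\<integral>\<^sup>+x. W x \<partial>lborel) = ennreal mean"
    using survival_integral W0 unfolding W_def mean_def
    by (simp add: has_bochner_integral_iff nn_integral_eq_integral)
  then have dil: "(\<integral>\<^sup>+x. W (x * exp s) \<partial>lborel) = ennreal (exp (- s)) * ennreal mean" for s
    using nn_integral_dilation[of "\<lambda>x. ennreal (W x)"] by simp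
  have "ennreal (indicator {0<..} x * (1 - smooth P Y x)) = (\<integral>\<^sup>+y. W (x * exp (Y y)) \<partial>P)" for x
  proof -
    have "integrable P (\<lambda>y. W (x * exp (Y y)))"
      unfolding W_exp using integrable_F[OF assms(1,2)] by simp
    moreover have "(\<integral>y. W (x * exp (Y y)) \<partial>P) = indicator {0<..} x * (1 - smooth P Y x)"
      unfolding W_exp smooth_def using integrable_F[OF assms(1,2)] by (simp add: P.prob_space)
    ultimately show ?thesis
      using W0 by (subst nn_integral_eq_integral) auto
  qed
  then have "(\<integral>\<^sup>+x. ennreal (indicator {0<..} x * (1 - smooth P Y x)) \<partial>lborel)
      = (\<integral>\<^sup>+x. \<integral>\<^sup>+y. W (x * exp (Y y)) \<partial>P \<partial>lborel)"
    by simp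
  also have "\<dots> = (\<integral>\<^sup>+y. \<integral>\<^sup>+x. W (x * exp (Y y)) \<partial>lborel \<partial>P)"
    by (rule Fubini') measurable
  also have "\<dots> = ennreal (\<integral>y. exp (- Y y) \<partial>P) * ennreal mean"
    unfolding dil using Y by (simp add: nn_integral_multc nn_integral_eq_integral)
  also have "\<dots> = ennreal (mean * (\<integral>y. exp (- Y y) \<partial>P))"
    using \<open>0 \<le> mean\<close> by (simp add: ennreal_mult mult.commute)
  finally show "(\<integral>\<^sup>+x. ennreal (indicator {0<..} x * (1 - smooth P Y x)) \<partial>lborel) = \<dots>" .
qed

text \<open>\<open>sm\<close> is \<open>G\<close> and \<open>sm_min\<close> is
  \<open>G\<^sub>2\<close> of the overview, with the dependence on \<open>\<sigma>\<close> made
  visible.\<close>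

abbreviation "sm \<sigma> \<equiv> smooth std_normal_distribution (\<lambda>z. \<sigma> * z)"
abbreviation "sm_min \<sigma> \<equiv> smooth std_normal_pair (\<lambda>p. \<sigma> * min (fst p) (snd p))"

lemma sm_survival:
  "has_bochner_integral lborel (\<lambda>x. indicator {0<..} x * (1 - sm \<sigma> x))
     (mean * (\<integral>z. exp (- (\<sigma> * z)) \<partial>std_normal_distribution))"
  using integrable_std_normal_exp[of "- \<sigma>"]
  by (intro smooth_survival prob_space_std_normal) auto

lemma sm_min_survival:
  "has_bochner_integral lborel (\<lambda>x. indicator {0<..} x * (1 - sm_min \<sigma> x))
     (mean * (\<integral>p. exp (- (\<sigma> * min (fst p) (snd p))) \<partial>std_normal_pair))"
  using integrable_std_normal_pair_exp_min(1)[of "- \<sigma>"]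
  by (intro smooth_survival prob_space_std_normal_pair) auto

lemma sm_measurable [measurable]:
  "sm \<sigma> \<in> borel_measurable borel" "sm_min \<sigma> \<in> borel_measurable borel"
  by (auto intro!: smooth_measurable prob_space_std_normal prob_space_std_normal_pair)

lemma sm_bounds: "0 \<le> sm \<sigma> x" "sm \<sigma> x \<le> 1" "0 \<le> sm_min \<sigma> x" "sm_min \<sigma> x \<le> 1"
  by (auto intro!: smooth_bounds prob_space_std_normal prob_space_std_normal_pair)

lemma integrable_F_variance: "integrable lborel (\<lambda>x. F x * (1 - F x))"
proof (rule Bochner_Integration.integrable_bound)
  show "integrable lborel (\<lambda>x. indicator {0<..} x * (1 - F x))"
    using survival_integral by (simp add: has_bochner_integral_iff)
  show "AE x in lborel. norm (F x * (1 - F x)) \<le> norm (indicator {0<..} x * (1 - F x))"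
    using F_nonneg F_le_1 F_nonpos
    by (intro AE_I2) (auto simp: indicator_def abs_mult mult_left_le_one_le)
qed measurable

lemma integrable_sm_diff: "integrable lborel (\<lambda>x. sm \<sigma> x - F x)"
proof -
  have "integrable lborel (\<lambda>x. indicator {0<..} x * (1 - F x) - indicator {0<..} x * (1 - sm \<sigma> x))"
    using survival_integral sm_survival by (auto simp: has_bochner_integral_iff)
  also have "(\<lambda>x. indicator {0<..} x * (1 - F x) - indicator {0<..} x * (1 - sm \<sigma> x)) = (\<lambda>x. sm \<sigma> x - F x)"
    by (auto simp: indicator_def F_nonpos smooth_nonpos)
  finally show ?thesis .
qed

lemma sm_min_diff:
  "has_bochner_integral lborel (\<lambda>x. sm_min \<sigma> x - F x)
    (- mean * ((\<integral>p. exp (- (\<sigma> * min (fst p) (snd p))) \<partial>std_normal_pair) - 1))"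
proof -
  have "has_bochner_integral lborel
      (\<lambda>x. indicator {0<..} x * (1 - F x) - indicator {0<..} x * (1 - sm_min \<sigma> x))
      (mean - mean * (\<integral>p. exp (- (\<sigma> * min (fst p) (snd p))) \<partial>std_normal_pair))"
    using survival_integral sm_min_survival unfolding mean_def by (rule has_bochner_integral_diff)
  also have "(\<lambda>x. indicator {0<..} x * (1 - F x) - indicator {0<..} x * (1 - sm_min \<sigma> x)) = (\<lambda>x. sm_min \<sigma> x - F x)"
    by (auto simp: indicator_def F_nonpos smooth_nonpos)
  finally show ?thesis
    by (simp add: algebra_simps)
qed

text \<open>Squares of numbers between 0 and 1 differ by at most twice the difference of the
  numbers, so this term inherits the L^1 rate of \<open>sm \<sigma> - F\<close>.\<close>

lemma integrable_sm_power2_diff: "integrable lborel (\<lambda>x. (sm \<sigma> x)\<^sup>2 - (F x)\<^sup>2)"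
  and integral_sm_power2_diff_le:
    "\<bar>\<integral>x. (sm \<sigma> x)\<^sup>2 - (F x)\<^sup>2 \<partial>lborel\<bar> \<le> 2 * (\<integral>x. \<bar>sm \<sigma> x - F x\<bar> \<partial>lborel)"
proof -
  have b: "\<bar>(sm \<sigma> x)\<^sup>2 - (F x)\<^sup>2\<bar> \<le> 2 * \<bar>sm \<sigma> x - F x\<bar>" for x
  proof -
    have "\<bar>(sm \<sigma> x)\<^sup>2 - (F x)\<^sup>2\<bar> = \<bar>sm \<sigma> x + F x\<bar> * \<bar>sm \<sigma> x - F x\<bar>"
      by (simp add: abs_mult[symmetric] power2_eq_square algebra_simps)
    also have "\<dots> \<le> 2 * \<bar>sm \<sigma> x - F x\<bar>"
      using sm_bounds[of \<sigma> x] F_nonneg[of x] F_le_1[of x] by (intro mult_right_mono) auto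
    finally show ?thesis .
  qed
  have d: "integrable lborel (\<lambda>x. 2 * \<bar>sm \<sigma> x - F x\<bar>)"
    using integrable_sm_diff by auto
  show i: "integrable lborel (\<lambda>x. (sm \<sigma> x)\<^sup>2 - (F x)\<^sup>2)"
    by (rule Bochner_Integration.integrable_bound[OF d]) (use b in auto)
  have "\<bar>\<integral>x. (sm \<sigma> x)\<^sup>2 - (F x)\<^sup>2 \<partial>lborel\<bar> \<le> (\<integral>x. \<bar>(sm \<sigma> x)\<^sup>2 - (F x)\<^sup>2\<bar> \<partial>lborel)"
    by (rule integral_abs_bound)
  also have "\<dots> \<le> (\<integral>x. 2 * \<bar>sm \<sigma> x - F x\<bar> \<partial>lborel)"
    using i d b by (intro integral_mono) auto
  finally show "\<bar>\<integral>x. (sm \<sigma> x)\<^sup>2 - (F x)\<^sup>2 \<partial>lborel\<bar> \<le> 2 * (\<integral>x. \<bar>sm \<sigma> x - F x\<bar> \<partial>lborel)"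
    by simp
qed

text \<open>The integrand splits as
  \<open>F (1 - F) + (sm_min - F) - (sm\<^sup>2 - F\<^sup>2)\<close>: the limit, the part that
  scaling evaluates exactly, and the part that is negligible against
  \<open>\<sigma>\<close>.\<close>

lemma integrable_sm_variance: "integrable lborel (\<lambda>x. sm_min \<sigma> x - (sm \<sigma> x)\<^sup>2)"
  and integral_sm_variance:
    "(\<integral>x. sm_min \<sigma> x - (sm \<sigma> x)\<^sup>2 \<partial>lborel) = (\<integral>x. F x * (1 - F x) \<partial>lborel)
       - mean * ((\<integral>p. exp (- (\<sigma> * min (fst p) (snd p))) \<partial>std_normal_pair) - 1)
       - (\<integral>x. (sm \<sigma> x)\<^sup>2 - (F x)\<^sup>2 \<partial>lborel)"
proof -
  have *: "(\<lambda>x. sm_min \<sigma> x - (sm \<sigma> x)\<^sup>2) = (\<lambda>x. F x * (1 - F x) + (sm_min \<sigma> x - F x) - ((sm \<sigma> x)\<^sup>2 - (F x)\<^sup>2))"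
    by (auto simp: power2_eq_square algebra_simps)
  note i = integrable_F_variance sm_min_diff[of \<sigma>, THEN has_bochner_integral_iff[THEN iffD1], THEN conjunct1]
    integrable_sm_power2_diff[of \<sigma>]
  show "integrable lborel (\<lambda>x. sm_min \<sigma> x - (sm \<sigma> x)\<^sup>2)"
    unfolding * by (rule Bochner_Integration.integrable_diff[OF Bochner_Integration.integrable_add[OF i(1,2)] i(3)])
  have "(\<integral>x. sm_min \<sigma> x - F x \<partial>lborel)
      = - mean * ((\<integral>p. exp (- (\<sigma> * min (fst p) (snd p))) \<partial>std_normal_pair) - 1)"
    using sm_min_diff by (rule has_bochner_integral_integral_eq)
  then show "(\<integral>x. sm_min \<sigma> x - (sm \<sigma> x)\<^sup>2 \<partial>lborel) = (\<integral>x. F x * (1 - F x) \<partial>lborel)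
       - mean * ((\<integral>p. exp (- (\<sigma> * min (fst p) (snd p))) \<partial>std_normal_pair) - 1)
       - (\<integral>x. (sm \<sigma> x)\<^sup>2 - (F x)\<^sup>2 \<partial>lborel)"
    unfolding *
    using Bochner_Integration.integral_diff[OF Bochner_Integration.integrable_add[OF i(1,2)] i(3)]
      Bochner_Integration.integral_add[OF i(1,2)] by linarith
qed

lemma integrable_sm_bias_power2: "integrable lborel (\<lambda>x. (sm \<sigma> x - F x)\<^sup>2)"
proof (rule Bochner_Integration.integrable_bound[OF integrable_sm_diff])
  show "AE x in lborel. norm ((sm \<sigma> x - F x)\<^sup>2) \<le> norm (sm \<sigma> x - F x)"
  proof (rule AE_I2)
    fix x
    have "\<bar>sm \<sigma> x - F x\<bar> * \<bar>sm \<sigma> x - F x\<bar> \<le> 1 * \<bar>sm \<sigma> x - F x\<bar>"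
      using sm_bounds[of \<sigma> x] F_nonneg[of x] F_le_1[of x] by (intro mult_right_mono) auto
    then show "norm ((sm \<sigma> x - F x)\<^sup>2) \<le> norm (sm \<sigma> x - F x)"
      by (simp add: power2_eq_square abs_mult)
  qed
qed measurable

section \<open>Taylor expansion along the dilation flow\<close>

text \<open>Running the flow at speed \<open>s\<close> reaches the exponent \<open>s\<close>, of
  either sign, at \<open>t = 1\<close>; all remainders then live on one fixed interval.\<close>

lemma dilated_derivatives:
  "((\<lambda>t. F (x * exp (t * s))) has_real_derivative g (x * exp (t * s)) * s) (at t)"
  "((\<lambda>t. g (x * exp (t * s))) has_real_derivative h (x * exp (t * s)) * s) (at t)"
proof -
  have "((\<lambda>t. t * s) has_real_derivative s) (at t)"
    by (auto intro!: derivative_eq_intros)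
  from DERIV_chain2[OF F_deriv this] DERIV_chain2[OF g_deriv this]
  show "((\<lambda>t. F (x * exp (t * s))) has_real_derivative g (x * exp (t * s)) * s) (at t)"
    "((\<lambda>t. g (x * exp (t * s))) has_real_derivative h (x * exp (t * s)) * s) (at t)"
    by simp_all
qed

lemma isCont_dilated: "isCont (\<lambda>t. h (x * exp (t * s))) t"
  using isCont_o2[of t "\<lambda>t. t * s" "\<lambda>s. h (x * exp s)"] h_cont by auto

text \<open>The remainder is expressed by differences of \<open>g\<close> rather than by
  \<open>h\<close>, because it will be integrated over \<open>x\<close> in L^1, where only
  \<open>g\<close> is under control.\<close>

lemma Taylor1:
  "F (x * exp s) - F x - s * g x = (\<integral>t. s * (g (x * exp (t * s)) - g x) \<partial>unit_interval_measure)"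
proof -
  have "((\<lambda>t. F (x * exp (t * s)) - t * s * g x) has_real_derivative s * (g (x * exp (t * s)) - g x)) (at t)" for t
    by (auto intro!: derivative_eq_intros dilated_derivatives simp: algebra_simps)
  moreover have "isCont (\<lambda>t. s * (g (x * exp (t * s)) - g x)) t" for t
    using DERIV_isCont[OF dilated_derivatives(2)] by simp
  ultimately show ?thesis
    using integral_unit_interval_FTC[of "\<lambda>t. F (x * exp (t * s)) - t * s * g x" "\<lambda>t. s * (g (x * exp (t * s)) - g x)"]
    by simp
qed

lemma Taylor2:
  "F (x * exp s) - F x - s * g x - s\<^sup>2 * (h x / 2)
    = (\<integral>t. s\<^sup>2 * \<bar>1 - t\<bar> * (h (x * exp (t * s)) - h x) \<partial>unit_interval_measure)"
proof -
  \<comment> \<open>Integration by parts: the first two summands have derivative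
    \<open>s\<^sup>2 * (1 - t) * h (x * exp (t * s))\<close>, and the third subtracts the same
    weight times the constant \<open>h x\<close>.\<close>
  let ?\<Phi> = "\<lambda>t. (1 - t) * s * g (x * exp (t * s)) + F (x * exp (t * s)) + s\<^sup>2 * h x * ((1 - t)\<^sup>2 / 2)"
  have "(?\<Phi> has_real_derivative s\<^sup>2 * (1 - t) * (h (x * exp (t * s)) - h x)) (at t)" for t
    by (auto intro!: derivative_eq_intros dilated_derivatives simp: power2_eq_square field_simps)
  moreover have "isCont (\<lambda>t. s\<^sup>2 * (1 - t) * (h (x * exp (t * s)) - h x)) t" for t
    using isCont_dilated by (intro continuous_intros) auto
  ultimately have "(\<integral>t. s\<^sup>2 * (1 - t) * (h (x * exp (t * s)) - h x) \<partial>unit_interval_measure) = ?\<Phi> 1 - ?\<Phi> 0"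
    by (rule integral_unit_interval_FTC)
  also have "\<dots> = F (x * exp s) - F x - s * g x - s\<^sup>2 * (h x / 2)"
    by (simp add: algebra_simps)
  also have "(\<integral>t. s\<^sup>2 * (1 - t) * (h (x * exp (t * s)) - h x) \<partial>unit_interval_measure)
      = (\<integral>t. s\<^sup>2 * \<bar>1 - t\<bar> * (h (x * exp (t * s)) - h x) \<partial>unit_interval_measure)"
    by (intro integral_cong_AE eventually_mono[OF AE_unit_interval_measure]) auto
  finally show ?thesis ..
qed

text \<open>Polynomial growth in the dilated argument becomes exponential growth in the exponent,
  which a Gaussian integrates. Such bounds yield integrability in the noise at a fixed
  \<open>x\<close>; they grow with \<open>x\<close>, so the integrals over \<open>x\<close> rely on
  L^1 and L^2 instead.\<close>

lemma abs_g_dilated_le: "\<bar>g (x * exp s)\<bar> \<le> K * \<bar>x\<bar> * exp \<bar>s\<bar>"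
proof -
  have "\<bar>g (x * exp s)\<bar> \<le> K * (\<bar>x\<bar> * exp s)"
    using g_bound[of "x * exp s"] by (simp add: abs_mult)
  also have "\<dots> \<le> K * (\<bar>x\<bar> * exp \<bar>s\<bar>)"
    using K_nonneg by (intro mult_left_mono) auto
  finally show ?thesis
    by (simp add: mult.assoc)
qed

lemma abs_h_dilated_le: "\<bar>h (x * exp s)\<bar> \<le> K * (\<bar>x\<bar> + x\<^sup>2) * exp (2 * \<bar>s\<bar>)"
proof -
  have e: "exp s \<le> exp (2 * \<bar>s\<bar>)" "(exp s)\<^sup>2 \<le> exp (2 * \<bar>s\<bar>)"
    by (auto simp: power2_eq_square exp_add[symmetric])
  have "\<bar>h (x * exp s)\<bar> \<le> K * (\<bar>x\<bar> * exp s + x\<^sup>2 * (exp s)\<^sup>2)"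
    using h_bound[of "x * exp s"] by (simp add: abs_mult power_mult_distrib)
  also have "\<dots> \<le> K * (\<bar>x\<bar> * exp (2 * \<bar>s\<bar>) + x\<^sup>2 * exp (2 * \<bar>s\<bar>))"
    using K_nonneg e by (intro mult_left_mono add_mono) auto
  finally show ?thesis
    by (simp add: algebra_simps)
qed

lemma abs_g_diff_le:
  assumes "0 < \<sigma>" "\<sigma> \<le> 1" "0 \<le> t" "t \<le> 1"
  shows "\<bar>g (x * exp (\<sigma> * (t * z))) - g x\<bar> \<le> 2 * K * \<bar>x\<bar> * exp \<bar>z\<bar>"
proof -
  have "K * \<bar>x\<bar> * exp \<bar>\<sigma> * (t * z)\<bar> \<le> K * \<bar>x\<bar> * exp \<bar>z\<bar>" "K * \<bar>x\<bar> * exp \<bar>0\<bar> \<le> K * \<bar>x\<bar> * exp \<bar>z\<bar>"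
    by (intro mult_left_mono; use K_nonneg abs_dilation_exponent_le[OF assms, of z] in simp)+
  then show ?thesis
    using abs_g_dilated_le[of x "\<sigma> * (t * z)"] abs_g_dilated_le[of x 0]
    by (intro order_trans[OF abs_triangle_ineq4]) simp
qed

lemma abs_h_diff_le:
  assumes "0 < \<sigma>" "\<sigma> \<le> 1" "0 \<le> t" "t \<le> 1"
  shows "\<bar>h (x * exp (\<sigma> * (t * z))) - h x\<bar> \<le> 2 * K * (\<bar>x\<bar> + x\<^sup>2) * exp (2 * \<bar>z\<bar>)"
proof -
  have "K * (\<bar>x\<bar> + x\<^sup>2) * exp (2 * \<bar>\<sigma> * (t * z)\<bar>) \<le> K * (\<bar>x\<bar> + x\<^sup>2) * exp (2 * \<bar>z\<bar>)"
    "K * (\<bar>x\<bar> + x\<^sup>2) * exp (2 * \<bar>0\<bar>) \<le> K * (\<bar>x\<bar> + x\<^sup>2) * exp (2 * \<bar>z\<bar>)"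
    by (intro mult_left_mono; use K_nonneg abs_dilation_exponent_le[OF assms, of z] in simp)+
  then show ?thesis
    using abs_h_dilated_le[of x "\<sigma> * (t * z)"] abs_h_dilated_le[of x 0]
    by (intro order_trans[OF abs_triangle_ineq4]) simp
qed

text \<open>The linear term \<open>\<sigma> * z * g x\<close> has Gaussian mean 0 and can be
  subtracted freely, which leaves differences of \<open>g\<close>. With the minimum in place of
  \<open>z\<close> its mean would not vanish.\<close>

lemma sm_first_order:
  assumes "0 < \<sigma>" "\<sigma> \<le> 1"
  shows "sm \<sigma> x - F x = (\<integral>p. \<sigma> * (fst p * (g (x * exp (\<sigma> * (snd p * fst p))) - g x)) \<partial>std_normal_unit)"
    and "integrable std_normal_unit (\<lambda>p. \<sigma> * (fst p * (g (x * exp (\<sigma> * (snd p * fst p))) - g x)))"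
proof -
  interpret N: prob_space std_normal_distribution
    by (rule prob_space_std_normal)
  let ?\<phi> = "\<lambda>p. \<sigma> * (fst p * (g (x * exp (\<sigma> * (snd p * fst p))) - g x))"
  have B: "integrable std_normal_distribution (\<lambda>z. 2 * K * \<bar>x\<bar> * (\<bar>z\<bar> ^ 1 * exp (1 * \<bar>z\<bar>)))"
    by (intro integrable_mult_right integrable_std_normal_power_exp)
  have b: "\<bar>?\<phi> (z, t)\<bar> \<le> 2 * K * \<bar>x\<bar> * (\<bar>z\<bar> ^ 1 * exp (1 * \<bar>z\<bar>))" if "0 \<le> t" "t \<le> 1" for z t
  proof -
    have "\<bar>?\<phi> (z, t)\<bar> = \<sigma> * (\<bar>z\<bar> * \<bar>g (x * exp (\<sigma> * (t * z))) - g x\<bar>)"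
      using assms by (simp add: abs_mult)
    also have "\<dots> \<le> 1 * (\<bar>z\<bar> * (2 * K * \<bar>x\<bar> * exp \<bar>z\<bar>))"
      using assms that abs_g_diff_le by (intro mult_mono) auto
    finally show ?thesis
      by (simp add: ac_simps)
  qed
  have [measurable]: "?\<phi> \<in> borel_measurable (borel \<Otimes>\<^sub>M borel)"
    by measurable
  note PU = integrable_std_normal_unit[of ?\<phi>, OF _ B b]
  show "integrable std_normal_unit ?\<phi>"
    by (rule PU) auto
  have i: "integrable std_normal_distribution (\<lambda>z. F (x * exp (\<sigma> * z)))"
    by (rule integrable_F[OF prob_space_std_normal]) simp
  have "sm \<sigma> x - F x = (\<integral>z. F (x * exp (\<sigma> * z)) - F x - (\<sigma> * z) * g x \<partial>std_normal_distribution)"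
    using i integral_std_normal_id N.prob_space by (simp add: smooth_def)
  also have "\<dots> = (\<integral>z. \<integral>t. ?\<phi> (z, t) \<partial>unit_interval_measure \<partial>std_normal_distribution)"
    unfolding Taylor1 by (simp add: ac_simps)
  also have "\<dots> = (\<integral>p. ?\<phi> p \<partial>std_normal_unit)"
    by (rule PU(2)[symmetric]) auto
  finally show "sm \<sigma> x - F x = (\<integral>p. ?\<phi> p \<partial>std_normal_unit)" .
qed

text \<open>\<open>E Z = 0\<close> removes the linear term and \<open>E Z\<^sup>2 = 1\<close> turns
  the quadratic one into \<open>\<sigma>\<^sup>2 * h x / 2\<close>. The remainder is split into a
  nonnegative weight \<open>w\<close> and an increment \<open>d\<close> in preparation for
  Cauchy-Schwarz, whose two integrability conditions are the remaining claims.\<close>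

lemma sm_second_order:
  assumes "0 < \<sigma>" "\<sigma> \<le> 1"
  defines "w \<equiv> \<lambda>p. (fst p)\<^sup>2 * \<bar>1 - snd p\<bar>" and "d \<equiv> \<lambda>x p. h (x * exp (\<sigma> * (snd p * fst p))) - h x"
  shows "(sm \<sigma> x - F x) / \<sigma>\<^sup>2 - h x / 2 = (\<integral>p. w p * d x p \<partial>std_normal_unit)"
    and "integrable std_normal_unit (\<lambda>p. w p * d x p)"
    and "integrable std_normal_unit (\<lambda>p. w p * (d x p)\<^sup>2)"
proof -
  interpret N: prob_space std_normal_distribution
    by (rule prob_space_std_normal)
  define C where "C = 2 * K * (\<bar>x\<bar> + x\<^sup>2)"
  have C: "0 \<le> C"
    using K_nonneg by (simp add: C_def)
  have B: "integrable std_normal_distribution (\<lambda>z. C * (\<bar>z\<bar> ^ 2 * exp (2 * \<bar>z\<bar>)))"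
    "integrable std_normal_distribution (\<lambda>z. C\<^sup>2 * (\<bar>z\<bar> ^ 2 * exp (4 * \<bar>z\<bar>)))"
    by (intro integrable_mult_right integrable_std_normal_power_exp)+
  have d: "\<bar>d x (z, t)\<bar> \<le> C * exp (2 * \<bar>z\<bar>)" if "0 \<le> t" "t \<le> 1" for z t
    using abs_h_diff_le[OF assms(1,2) that, of x z] by (simp add: d_def C_def)
  have w: "\<bar>w (z, t)\<bar> \<le> \<bar>z\<bar>\<^sup>2" if "0 \<le> t" "t \<le> 1" for z t
    using that by (simp add: w_def abs_mult mult_right_le_one_le)
  have b: "\<bar>w (z, t) * d x (z, t)\<bar> \<le> C * (\<bar>z\<bar> ^ 2 * exp (2 * \<bar>z\<bar>))" if "0 \<le> t" "t \<le> 1" for z t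
    using mult_mono[OF w[OF that] d[OF that]] by (simp add: abs_mult ac_simps)
  have b2: "\<bar>w (z, t) * (d x (z, t))\<^sup>2\<bar> \<le> C\<^sup>2 * (\<bar>z\<bar> ^ 2 * exp (4 * \<bar>z\<bar>))" if "0 \<le> t" "t \<le> 1" for z t
  proof -
    have "(d x (z, t))\<^sup>2 \<le> (C * exp (2 * \<bar>z\<bar>))\<^sup>2"
      using d[OF that, of z] C by (intro abs_le_square_iff[THEN iffD1]) auto
    also have "\<dots> = C\<^sup>2 * exp (4 * \<bar>z\<bar>)"
      by (simp add: power_mult_distrib power2_eq_square exp_add[symmetric])
    finally have "\<bar>w (z, t)\<bar> * (d x (z, t))\<^sup>2 \<le> \<bar>z\<bar>\<^sup>2 * (C\<^sup>2 * exp (4 * \<bar>z\<bar>))"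
      using w[OF that, of z] by (intro mult_mono) auto
    then show ?thesis
      by (simp add: abs_mult ac_simps)
  qed
  have [measurable]: "w \<in> borel_measurable (borel \<Otimes>\<^sub>M borel)" "d x \<in> borel_measurable (borel \<Otimes>\<^sub>M borel)"
    unfolding w_def d_def by measurable
  note PU = integrable_std_normal_unit[of "\<lambda>p. w p * d x p", OF _ B(1) b]
  show "integrable std_normal_unit (\<lambda>p. w p * d x p)"
    by (rule PU) auto
  show "integrable std_normal_unit (\<lambda>p. w p * (d x p)\<^sup>2)"
    by (rule integrable_std_normal_unit(1)[OF _ B(2) b2]) auto
  have i: "integrable std_normal_distribution (\<lambda>z. F (x * exp (\<sigma> * z)))"
    by (rule integrable_F[OF prob_space_std_normal]) simp
  have "sm \<sigma> x - F x - \<sigma>\<^sup>2 * (h x / 2)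
      = (\<integral>z. F (x * exp (\<sigma> * z)) - F x - (\<sigma> * z) * g x - (\<sigma> * z)\<^sup>2 * (h x / 2) \<partial>std_normal_distribution)"
    using i integral_std_normal_id integral_std_normal_power2 N.prob_space
    by (simp add: smooth_def power_mult_distrib)
  also have "\<dots> = (\<integral>z. \<sigma>\<^sup>2 * (\<integral>t. w (z, t) * d x (z, t) \<partial>unit_interval_measure) \<partial>std_normal_distribution)"
    unfolding Taylor2 by (simp add: w_def d_def power_mult_distrib ac_simps flip: integral_mult_right_zero)
  also have "\<dots> = \<sigma>\<^sup>2 * (\<integral>p. w p * d x p \<partial>std_normal_unit)"
    by (subst PU(2)) auto
  finally show "(sm \<sigma> x - F x) / \<sigma>\<^sup>2 - h x / 2 = (\<integral>p. w p * d x p \<partial>std_normal_unit)"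
    using assms(1) by (simp add: field_simps)
qed

text \<open>After division by \<open>\<sigma>\<close> the triangle inequality leaves an averaged L^1
  distance between \<open>g\<close> and its dilates, with weight
  \<open>\<bar>z\<bar>\<close>.\<close>

lemma sm_diff_L1:
  assumes \<sigma>: "\<sigma> \<longlonglongrightarrow> 0" "\<And>n. 0 < \<sigma> n" "\<And>n. \<sigma> n \<le> 1"
  shows "(\<lambda>n. (\<integral>x. \<bar>sm (\<sigma> n) x - F x\<bar> \<partial>lborel) / \<sigma> n) \<longlonglongrightarrow> 0"
proof (rule ennreal_tendsto_0_bound)
  interpret PU: pair_prob_space std_normal_distribution unit_interval_measure
    by (rule pair_prob_space_std_normal_unit)
  show "0 \<le> (\<integral>x. \<bar>sm (\<sigma> n) x - F x\<bar> \<partial>lborel) / \<sigma> n" for n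
    using \<sigma>(2)[of n] by simp
  let ?D = "\<lambda>n x. \<integral>\<^sup>+p. ennreal (\<bar>fst p\<bar> * \<bar>g (x * exp (\<sigma> n * (snd p * fst p))) - g x\<bar> ^ 1) \<partial>std_normal_unit"
  show "ennreal ((\<integral>x. \<bar>sm (\<sigma> n) x - F x\<bar> \<partial>lborel) / \<sigma> n) \<le> (\<integral>\<^sup>+x. ?D n x \<partial>lborel)" for n
  proof -
    have "ennreal (\<bar>sm (\<sigma> n) x - F x\<bar> / \<sigma> n) \<le> ?D n x" for x
    proof -
      have "(sm (\<sigma> n) x - F x) / \<sigma> n = (\<integral>p. fst p * (g (x * exp (\<sigma> n * (snd p * fst p))) - g x) \<partial>std_normal_unit)"
        using \<sigma>(2)[of n] sm_first_order(1)[OF \<sigma>(2,3), of n x] by simp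
      moreover have "\<bar>sm (\<sigma> n) x - F x\<bar> / \<sigma> n = \<bar>(sm (\<sigma> n) x - F x) / \<sigma> n\<bar>"
        using \<sigma>(2)[of n] by simp
      moreover have "integrable std_normal_unit (\<lambda>p. fst p * (g (x * exp (\<sigma> n * (snd p * fst p))) - g x))"
        using sm_first_order(2)[OF \<sigma>(2,3), of n x] \<sigma>(2)[of n] by simp
      ultimately show ?thesis
        using integral_norm_bound_ennreal[of std_normal_unit "\<lambda>p. fst p * (g (x * exp (\<sigma> n * (snd p * fst p))) - g x)"]
          by (simp add: abs_mult)
    qed
    then have "(\<integral>\<^sup>+x. ennreal (\<bar>sm (\<sigma> n) x - F x\<bar> / \<sigma> n) \<partial>lborel) \<le> (\<integral>\<^sup>+x. ?D n x \<partial>lborel)"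
      by (intro nn_integral_mono)
    also have "(\<integral>\<^sup>+x. ennreal (\<bar>sm (\<sigma> n) x - F x\<bar> / \<sigma> n) \<partial>lborel)
        = ennreal ((\<integral>x. \<bar>sm (\<sigma> n) x - F x\<bar> \<partial>lborel) / \<sigma> n)"
      using \<sigma>(2)[of n] integrable_sm_diff[of "\<sigma> n"] by (subst nn_integral_eq_integral) auto
    finally show ?thesis .
  qed
  show "(\<lambda>n. \<integral>\<^sup>+x. ?D n x \<partial>lborel) \<longlonglongrightarrow> 0"
  proof (rule averaged_dilation_tendsto)
    show "sigma_finite_measure std_normal_unit" ..
    show "isCont (\<lambda>s. g (x * exp s)) 0" for x
      using DERIV_isCont[OF g_deriv] .
    show "integrable lborel (\<lambda>x. \<bar>g x\<bar> ^ 1)"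
      using g_integrable by simp
    show "integrable std_normal_unit (\<lambda>p. \<bar>fst p\<bar> * exp \<bar>snd p * fst p\<bar>)"
    proof (rule integrable_std_normal_unit(1)[OF _ integrable_std_normal_power_exp[of 1 1]])
      show "\<bar>\<bar>fst (z, t)\<bar> * exp \<bar>snd (z, t) * fst (z, t)\<bar>\<bar> \<le> \<bar>z\<bar> ^ 1 * exp (1 * \<bar>z\<bar>)"
        if "0 \<le> t" "t \<le> 1" for z t :: real
      proof -
        have "\<bar>z\<bar> * exp \<bar>t * z\<bar> \<le> \<bar>z\<bar> * exp \<bar>z\<bar>"
          using abs_dilation_exponent_le[of 1 t z] that by (intro mult_left_mono) auto
        then show ?thesis
          by (simp add: abs_of_nonneg)
      qed
    qed measurable
    show "\<bar>\<sigma> n\<bar> \<le> 1" for n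
      using \<sigma>(2,3)[of n] by simp
  qed (use \<sigma> in auto)
qed

text \<open>Cauchy-Schwarz moves the square inside the average over \<open>(z, t)\<close>, after
  which the averaged L^2 distance between \<open>h\<close> and its dilates takes over.\<close>

lemma sm_bias_L2:
  assumes \<sigma>: "\<sigma> \<longlonglongrightarrow> 0" "\<And>n. 0 < \<sigma> n" "\<And>n. \<sigma> n \<le> 1"
  shows "(\<lambda>n. \<integral>x. ((sm (\<sigma> n) x - F x) / (\<sigma> n)\<^sup>2 - h x / 2)\<^sup>2 \<partial>lborel) \<longlonglongrightarrow> 0"
proof (rule ennreal_tendsto_0_bound)
  interpret PU: pair_prob_space std_normal_distribution unit_interval_measure
    by (rule pair_prob_space_std_normal_unit)
  let ?w = "\<lambda>p. (fst p)\<^sup>2 * \<bar>1 - snd p\<bar>"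
  let ?d = "\<lambda>n x p. h (x * exp (\<sigma> n * (snd p * fst p))) - h x"
  let ?D = "\<lambda>n x. \<integral>\<^sup>+p. ennreal (?w p * \<bar>?d n x p\<bar> ^ 2) \<partial>std_normal_unit"
  show "ennreal (\<integral>x. ((sm (\<sigma> n) x - F x) / (\<sigma> n)\<^sup>2 - h x / 2)\<^sup>2 \<partial>lborel) \<le> (\<integral>\<^sup>+x. ?D n x \<partial>lborel)" for n
  proof -
    have i: "integrable lborel (\<lambda>x. ((sm (\<sigma> n) x - F x) / (\<sigma> n)\<^sup>2 - h x / 2)\<^sup>2)"
    proof (rule Bochner_Integration.integrable_bound)
      show "integrable lborel (\<lambda>x. 2 * ((sm (\<sigma> n) x - F x) / (\<sigma> n)\<^sup>2)\<^sup>2 + 2 * (h x / 2)\<^sup>2)"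
        unfolding power_divide
        by (intro Bochner_Integration.integrable_add integrable_mult_right integrable_divide
            integrable_sm_bias_power2 h_integrable)
      show "AE x in lborel. norm (((sm (\<sigma> n) x - F x) / (\<sigma> n)\<^sup>2 - h x / 2)\<^sup>2)
          \<le> norm (2 * ((sm (\<sigma> n) x - F x) / (\<sigma> n)\<^sup>2)\<^sup>2 + 2 * (h x / 2)\<^sup>2)"
        using abs_diff_power_le[of 2] by (intro AE_I2) (simp only: real_norm_def, auto)
    qed measurable
    have "ennreal (((sm (\<sigma> n) x - F x) / (\<sigma> n)\<^sup>2 - h x / 2)\<^sup>2) \<le> ?D n x" for x
    proof -
      have "((sm (\<sigma> n) x - F x) / (\<sigma> n)\<^sup>2 - h x / 2)\<^sup>2 \<le> 1 / 2 * (\<integral>p. ?w p * (?d n x p)\<^sup>2 \<partial>std_normal_unit)"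
        unfolding sm_second_order(1)[OF \<sigma>(2,3)] integral_Taylor_weight(2)[symmetric]
        by (intro weighted_Cauchy_Schwarz integral_Taylor_weight sm_second_order(2,3) \<sigma>) auto
      \<comment> \<open>The factor 1/2 is given away: the bound tends to 0 anyway.\<close>
      also have "\<dots> \<le> 1 * (\<integral>p. ?w p * (?d n x p)\<^sup>2 \<partial>std_normal_unit)"
        by (intro mult_right_mono integral_nonneg_AE) auto
      finally have "ennreal (((sm (\<sigma> n) x - F x) / (\<sigma> n)\<^sup>2 - h x / 2)\<^sup>2)
          \<le> ennreal (\<integral>p. ?w p * (?d n x p)\<^sup>2 \<partial>std_normal_unit)"
        by (intro ennreal_leI) simp
      also have "\<dots> = ?D n x"
        using sm_second_order(3)[OF \<sigma>(2)[of n] \<sigma>(3)[of n], of x] by (subst nn_integral_eq_integral) auto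
      finally show ?thesis .
    qed
    then have "(\<integral>\<^sup>+x. ennreal (((sm (\<sigma> n) x - F x) / (\<sigma> n)\<^sup>2 - h x / 2)\<^sup>2) \<partial>lborel) \<le> (\<integral>\<^sup>+x. ?D n x \<partial>lborel)"
      by (intro nn_integral_mono)
    then show ?thesis
      using i by (subst (asm) nn_integral_eq_integral) auto
  qed
  show "(\<lambda>n. \<integral>\<^sup>+x. ?D n x \<partial>lborel) \<longlonglongrightarrow> 0"
  proof (rule averaged_dilation_tendsto)
    show "sigma_finite_measure std_normal_unit" ..
    show "isCont (\<lambda>s. h (x * exp s)) 0" for x
      by (rule h_cont)
    show "integrable lborel (\<lambda>x. \<bar>h x\<bar> ^ 2)"
      using h_integrable by simp
    show "integrable std_normal_unit (\<lambda>p. (fst p)\<^sup>2 * \<bar>1 - snd p\<bar> * exp \<bar>snd p * fst p\<bar>)"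
    proof (rule integrable_std_normal_unit(1)[OF _ integrable_std_normal_power_exp[of 2 1]])
      show "\<bar>(fst (z, t))\<^sup>2 * \<bar>1 - snd (z, t)\<bar> * exp \<bar>snd (z, t) * fst (z, t)\<bar>\<bar> \<le> \<bar>z\<bar> ^ 2 * exp (1 * \<bar>z\<bar>)"
        if "0 \<le> t" "t \<le> 1" for z t :: real
      proof -
        have "(z\<^sup>2 * \<bar>1 - t\<bar>) * exp \<bar>t * z\<bar> \<le> (z\<^sup>2 * 1) * exp \<bar>z\<bar>"
          using abs_dilation_exponent_le[of 1 t z] that
          by (intro mult_mono[of "z\<^sup>2 * \<bar>1 - t\<bar>"] mult_left_mono) auto
        then show ?thesis
          by (simp add: abs_of_nonneg)
      qed
    qed measurable
    show "\<bar>\<sigma> n\<bar> \<le> 1" for n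
      using \<sigma>(2,3)[of n] by simp
  qed (use \<sigma> in auto)
qed simp

lemma integrated_variance_tendsto:
  assumes \<sigma>: "\<sigma> \<longlonglongrightarrow> 0" "\<And>n. 0 < \<sigma> n" "\<And>n. \<sigma> n \<le> 1"
  shows "(\<lambda>n. ((\<integral>x. sm_min (\<sigma> n) x - (sm (\<sigma> n) x)\<^sup>2 \<partial>lborel) - (\<integral>x. F x * (1 - F x) \<partial>lborel)) / \<sigma> n)
    \<longlonglongrightarrow> - mean / sqrt pi"
proof -
  let ?E = "\<lambda>n. \<integral>p. exp (- (\<sigma> n * min (fst p) (snd p))) \<partial>std_normal_pair"
  let ?Q = "\<lambda>n. \<integral>x. (sm (\<sigma> n) x)\<^sup>2 - (F x)\<^sup>2 \<partial>lborel"
  \<comment> \<open>The negligible part; what then remains of the quotient is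
    \<open>exp_min_derivative\<close> times \<open>- mean\<close>.\<close>
  have Q: "(\<lambda>n. ?Q n / \<sigma> n) \<longlonglongrightarrow> 0"
  proof (rule Lim_null_comparison)
    have "norm (?Q n / \<sigma> n) \<le> 2 * ((\<integral>x. \<bar>sm (\<sigma> n) x - F x\<bar> \<partial>lborel) / \<sigma> n)" for n
      using integral_sm_power2_diff_le[of "\<sigma> n"] \<sigma>(2)[of n] by (simp add: divide_right_mono)
    then show "\<forall>\<^sub>F n in sequentially. norm (?Q n / \<sigma> n) \<le> 2 * ((\<integral>x. \<bar>sm (\<sigma> n) x - F x\<bar> \<partial>lborel) / \<sigma> n)"
      by simp
    show "(\<lambda>n. 2 * ((\<integral>x. \<bar>sm (\<sigma> n) x - F x\<bar> \<partial>lborel) / \<sigma> n)) \<longlonglongrightarrow> 0"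
      by (intro tendsto_mult_right_zero sm_diff_L1 \<sigma>)
  qed
  have "(\<lambda>n. - mean * ((?E n - 1) / \<sigma> n) - ?Q n / \<sigma> n) \<longlonglongrightarrow> - mean * (1 / sqrt pi) - 0"
    by (intro tendsto_diff tendsto_mult tendsto_const exp_min_derivative \<sigma> Q)
  moreover have "(A - m * (E - 1) - Q - A) / s = - m * ((E - 1) / s) - Q / s" for A m E Q s :: real
    by (simp add: diff_divide_distrib right_diff_distrib)
  ultimately show ?thesis
    by (simp add: integral_sm_variance)
qed

lemma integrated_bias_tendsto:
  assumes \<sigma>: "\<sigma> \<longlonglongrightarrow> 0" "\<And>n. 0 < \<sigma> n" "\<And>n. \<sigma> n \<le> 1"
  shows "(\<lambda>n. (\<integral>x. (sm (\<sigma> n) x - F x)\<^sup>2 \<partial>lborel) / (\<sigma> n) ^ 4) \<longlonglongrightarrow> (\<integral>x. (h x)\<^sup>2 / 4 \<partial>lborel)"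
proof -
  have "(\<lambda>n. \<integral>x. ((sm (\<sigma> n) x - F x) / (\<sigma> n)\<^sup>2)\<^sup>2 \<partial>lborel) \<longlonglongrightarrow> (\<integral>x. (h x / 2)\<^sup>2 \<partial>lborel)"
    using integrable_sm_bias_power2 h_integrable
    by (intro integral_power2_tendsto sm_bias_L2 \<sigma>) (auto simp: power_divide)
  then show ?thesis
    by (simp add: power_divide flip: power_mult)
qed

end

section \<open>Variance of independent sums and moments of the lognormal kernel\<close>

text \<open>Square integrability of the sum is carried through the induction, since the next step
  expands the square of the partial sum plus one more term.\<close>

lemma (in prob_space) variance_sum_indep:
  fixes Y :: "'i \<Rightarrow> 'a \<Rightarrow> real"
  assumes "finite I" "indep_vars (\<lambda>_. borel) Y I"
    and "\<And>i. i \<in> I \<Longrightarrow> integrable M (Y i)" "\<And>i. i \<in> I \<Longrightarrow> integrable M (\<lambda>\<omega>. (Y i \<omega>)\<^sup>2)"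
  shows "integrable M (\<lambda>\<omega>. (\<Sum>i\<in>I. Y i \<omega>)\<^sup>2) \<and> variance (\<lambda>\<omega>. \<Sum>i\<in>I. Y i \<omega>) = (\<Sum>i\<in>I. variance (Y i))"
  using assms
proof (induction I rule: finite_induct)
  case empty
  then show ?case by simp
next
  case (insert i I)
  define S where "S \<omega> = (\<Sum>i\<in>I. Y i \<omega>)" for \<omega>
  have ind: "indep_var borel (Y i) borel S"
    unfolding S_def using insert by (intro indep_vars_sum) auto
  have IH: "integrable M (\<lambda>\<omega>. (S \<omega>)\<^sup>2)" "variance S = (\<Sum>i\<in>I. variance (Y i))"
    unfolding S_def using insert.IH insert.prems indep_vars_subset[OF insert.prems(1), of I] by auto
  have Y: "integrable M (Y i)" "integrable M (\<lambda>\<omega>. (Y i \<omega>)\<^sup>2)" and S: "integrable M S"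
    unfolding S_def using insert.prems by auto
  have prod: "integrable M (\<lambda>\<omega>. Y i \<omega> * S \<omega>)"
      "expectation (\<lambda>\<omega>. Y i \<omega> * S \<omega>) = expectation (Y i) * expectation S"
    using indep_var_integrable[OF ind Y(1) S] indep_var_lebesgue_integral[OF ind Y(1) S] by auto
  have sq: "(Y i \<omega> + S \<omega>)\<^sup>2 = (Y i \<omega>)\<^sup>2 + 2 * (Y i \<omega> * S \<omega>) + (S \<omega>)\<^sup>2" for \<omega>
    by (simp add: power2_sum)
  have i: "integrable M (\<lambda>\<omega>. (Y i \<omega> + S \<omega>)\<^sup>2)"
    unfolding sq using Y prod IH by simp
  have "expectation (\<lambda>\<omega>. (Y i \<omega> + S \<omega>)\<^sup>2)
      = expectation (\<lambda>\<omega>. (Y i \<omega>)\<^sup>2) + 2 * (expectation (Y i) * expectation S) + expectation (\<lambda>\<omega>. (S \<omega>)\<^sup>2)"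
    unfolding sq using Y prod IH by simp
  moreover have "variance (\<lambda>\<omega>. Y i \<omega> + S \<omega>)
      = expectation (\<lambda>\<omega>. (Y i \<omega> + S \<omega>)\<^sup>2) - (expectation (\<lambda>\<omega>. Y i \<omega> + S \<omega>))\<^sup>2"
    using Y S i by (intro variance_eq) auto
  moreover have "expectation (\<lambda>\<omega>. Y i \<omega> + S \<omega>) = expectation (Y i) + expectation S"
    using Y S by simp
  moreover have "variance (Y i) = expectation (\<lambda>\<omega>. (Y i \<omega>)\<^sup>2) - (expectation (Y i))\<^sup>2"
      "variance S = expectation (\<lambda>\<omega>. (S \<omega>)\<^sup>2) - (expectation S)\<^sup>2"
    using Y S IH(1) by (simp_all only: variance_eq)
  ultimately have "variance (\<lambda>\<omega>. Y i \<omega> + S \<omega>) = variance (Y i) + variance S"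
    by (simp only: power2_sum)
  then show ?case
    using i IH(2) insert.hyps by (simp add: S_def)
qed

lemma (in prob_space) mean_square_error:
  fixes Z :: "'a \<Rightarrow> real"
  assumes "integrable M Z" "integrable M (\<lambda>\<omega>. (Z \<omega>)\<^sup>2)"
  shows "expectation (\<lambda>\<omega>. (Z \<omega> - a)\<^sup>2) = variance Z + (expectation Z - a)\<^sup>2"
  using assms prob_space by (simp add: variance_eq power2_diff) (simp add: algebra_simps power2_eq_square)

text \<open>Both sides are the probability that an observation with law \<open>M\<close> lies below
  an independent \<open>Y\<close>, computed by Fubini in the two orders. The inequality is strict,
  so continuity of the c.d.f. at \<open>Y y\<close> excludes an atom there.\<close>

lemma (in real_distribution) integral_measure_less:
  assumes "prob_space P" and [measurable]: "Y \<in> borel_measurable P"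
    and cont: "\<And>y. isCont (cdf M) (Y y)"
    and [measurable]: "k \<in> borel_measurable M"
    and k: "AE t in M. k t = measure P {y \<in> space P. t < Y y}"
  shows "(\<integral>t. k t \<partial>M) = (\<integral>y. cdf M (Y y) \<partial>P)"
proof -
  interpret Q: prob_space P by fact
  interpret MP: pair_prob_space M P ..
  have less: "measure M {..<y} = cdf M y" if "isCont (cdf M) y" for y
  proof -
    have "measure M ({..<y} \<union> {y}) = measure M {..<y} + measure M {y}"
      by (intro finite_measure_Union) auto
    moreover have "{..<y} \<union> {y} = {..y}"
      by auto
    ultimately show ?thesis
      using that by (simp add: isCont_cdf cdf_def2)
  qed
  define f :: "real \<Rightarrow> 'a \<Rightarrow> real" where "f t y = (if t < Y y then 1 else 0)" for t y
  have [measurable]: "case_prod f \<in> borel_measurable (M \<Otimes>\<^sub>M P)"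
    unfolding f_def by measurable
  have "integrable (M \<Otimes>\<^sub>M P) (case_prod f)"
    by (rule MP.integrable_const_bound[where B = 1]) (auto simp: f_def)
  from MP.Fubini_integral[OF this]
  have "(\<integral>y. \<integral>t. f t y \<partial>M \<partial>P) = (\<integral>t. \<integral>y. f t y \<partial>P \<partial>M)" .
  moreover have f: "(\<integral>y. f t y \<partial>P) = measure P {y \<in> space P. t < Y y}" for t
  proof -
    have "(\<integral>y. f t y \<partial>P) = (\<integral>y. indicator {y \<in> space P. t < Y y} y \<partial>P)"
      by (intro Bochner_Integration.integral_cong) (auto simp: f_def)
    then show ?thesis
      by simp
  qed
  moreover have "(\<integral>t. f t y \<partial>M) = cdf M (Y y)" for y
  proof -
    have "(\<integral>t. f t y \<partial>M) = (\<integral>t. indicator {..<Y y} t \<partial>M)"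
      by (intro Bochner_Integration.integral_cong) (auto simp: f_def)
    then show ?thesis
      using less[OF cont] by simp
  qed
  moreover have "(\<integral>t. k t \<partial>M) = (\<integral>t. \<integral>y. f t y \<partial>P \<partial>M)"
    using k by (intro integral_cong_AE) (auto simp: f)
  ultimately show ?thesis
    by simp
qed

lemma std_normal_cdf_bounds: "0 \<le> std_normal_cdf x" "std_normal_cdf x \<le> 1"
proof -
  interpret real_distribution std_normal_distribution
    by (rule real_dist_normal_dist)
  show "0 \<le> std_normal_cdf x" "std_normal_cdf x \<le> 1"
    by (auto simp: std_normal_cdf_def cdf_nonneg cdf_bounded_prob)
qed

lemma std_normal_cdf_measurable [measurable]: "std_normal_cdf \<in> borel_measurable borel"
proof -
  interpret real_distribution std_normal_distribution
    by (rule real_dist_normal_dist)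
  show ?thesis
    by (intro borel_measurable_mono monoI) (simp add: std_normal_cdf_def cdf_nondecreasing)
qed

lemma kernel_bounds:
  "0 \<le> lognormal_kernel_survival t \<mu> \<sigma>" "lognormal_kernel_survival t \<mu> \<sigma> \<le> 1"
  using std_normal_cdf_bounds by (auto simp: lognormal_kernel_survival_def)

lemma kernel_measurable [measurable (raw)]:
  assumes [measurable]: "u \<in> borel_measurable M" "v \<in> borel_measurable M"
  shows "(\<lambda>x. lognormal_kernel_survival (u x) (v x) \<sigma>) \<in> borel_measurable M"
  unfolding lognormal_kernel_survival_def by measurable

lemma kernel_eq_measure:
  assumes "0 < t" "0 < x" "0 < \<sigma>"
  shows "lognormal_kernel_survival t (ln x) \<sigma>
      = measure std_normal_distribution {z \<in> space std_normal_distribution. t < x * exp (\<sigma> * z)}"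
    and "(lognormal_kernel_survival t (ln x) \<sigma>)\<^sup>2
      = measure std_normal_pair {p \<in> space std_normal_pair. t < x * exp (\<sigma> * min (fst p) (snd p))}"
proof -
  interpret N: real_distribution std_normal_distribution
    by (rule real_dist_normal_dist)
  \<comment> \<open>The standardized threshold: the noise must exceed it for the dilated
    \<open>x\<close> to pass \<open>t\<close>.\<close>
  define a where "a = (ln t - ln x) / \<sigma>"
  have less_iff: "t < x * exp (\<sigma> * z) \<longleftrightarrow> a < z" for z
  proof -
    have "t < x * exp (\<sigma> * z) \<longleftrightarrow> ln t < ln x + \<sigma> * z"
      using assms by (subst ln_less_cancel_iff[symmetric]) (auto simp: ln_mult)
    also have "\<dots> \<longleftrightarrow> a < z"
      using assms by (auto simp: a_def field_simps)
    finally show ?thesis .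
  qed
  have "measure std_normal_distribution (space std_normal_distribution - {..a}) = 1 - measure std_normal_distribution {..a}"
    by (rule N.prob_compl) simp
  moreover have "space std_normal_distribution - {..a} = {a<..}"
    by auto
  ultimately have *: "lognormal_kernel_survival t (ln x) \<sigma> = measure std_normal_distribution {a<..}"
    by (simp add: lognormal_kernel_survival_def std_normal_cdf_def cdf_def2 a_def)
  also have "{a<..} = {z \<in> space std_normal_distribution. t < x * exp (\<sigma> * z)}"
    by (auto simp: less_iff)
  finally show "lognormal_kernel_survival t (ln x) \<sigma>
      = measure std_normal_distribution {z \<in> space std_normal_distribution. t < x * exp (\<sigma> * z)}" .
  \<comment> \<open>The minimum exceeds \<open>a\<close> exactly when both coordinates do, so the
    event is a product and its probability a square.\<close>
  have "{p \<in> space std_normal_pair. t < x * exp (\<sigma> * min (fst p) (snd p))} = {a<..} \<times> {a<..}"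
    by (auto simp: less_iff space_pair_measure)
  moreover have "measure std_normal_pair ({a<..} \<times> {a<..}) = (measure std_normal_distribution {a<..})\<^sup>2"
    by (simp add: measure_def N.emeasure_pair_measure_Times enn2real_mult power2_eq_square)
  ultimately show "(lognormal_kernel_survival t (ln x) \<sigma>)\<^sup>2
      = measure std_normal_pair {p \<in> space std_normal_pair. t < x * exp (\<sigma> * min (fst p) (snd p))}"
    using * by simp
qed

section \<open>The estimator from an independent sample at fixed \<open>n\<close> and
  \<open>b\<close>\<close>

locale LN_sample = prob_space M + dilation_smooth_cdf F g h K
  for M :: "'a measure" and F g h :: "real \<Rightarrow> real" and K :: real +
  fixes X :: "nat \<Rightarrow> 'a \<Rightarrow> real"
  assumes indep: "indep_vars (\<lambda>_. borel) X {1..}"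
    and cdf_X: "\<And>i. i \<ge> 1 \<Longrightarrow> cdf (distr M borel (X i)) = F"
begin

lemma X_measurable: "1 \<le> i \<Longrightarrow> random_variable borel (X i)"
  using indep by (auto simp: indep_vars_def)

text \<open>The analytic conditions describe \<open>F\<close> along the flow. Near a positive point,
  \<open>F\<close> is the flow started at 1, composed with \<open>ln\<close>.\<close>

lemma isCont_F:
  assumes "0 < y"
  shows "isCont F y"
proof -
  have "isCont ln y"
    using DERIV_ln[OF assms] by (rule DERIV_isCont)
  moreover have "isCont (\<lambda>s. F (1 * exp s)) (ln y)"
    using F_deriv by (rule DERIV_isCont)
  ultimately have c: "isCont (\<lambda>y. F (1 * exp (ln y))) y"
    by (rule isCont_o2)
  have e: "\<forall>\<^sub>F z in nhds y. F (1 * exp (ln z)) = F z"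
    using eventually_nhds_in_open[of "{0<..}" y] assms by (auto elim!: eventually_mono)
  show ?thesis
    by (rule isCont_cong[THEN iffD1, OF e c])
qed

lemma kernel_moments:
  assumes "1 \<le> i" "0 < x" "0 < \<sigma>"
  shows "expectation (\<lambda>\<omega>. lognormal_kernel_survival (X i \<omega>) (ln x) \<sigma>) = sm \<sigma> x"
    and "expectation (\<lambda>\<omega>. (lognormal_kernel_survival (X i \<omega>) (ln x) \<sigma>)\<^sup>2) = sm_min \<sigma> x"
proof -
  note [measurable] = X_measurable[OF assms(1)]
  interpret D: real_distribution "distr M borel (X i)"
    by simp
  note cdf = cdf_X[OF assms(1)]
  \<comment> \<open>Observations are almost surely positive because \<open>F 0 = 0\<close>; the
    probabilistic form of the kernel holds for positive \<open>t\<close>.\<close>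
  have "D.prob {..0} = 0"
    using fun_cong[OF cdf, of 0] F_nonpos[of 0] by (simp add: cdf_def2)
  then have pos: "AE t in distr M borel (X i). 0 < t"
    by (intro AE_I'[of "{..0}"]) (auto simp: null_sets_def D.emeasure_eq_measure)
  have cont: "isCont (cdf (distr M borel (X i))) (x * exp s)" for s
    unfolding cdf using assms by (intro isCont_F) simp
  have "expectation (\<lambda>\<omega>. lognormal_kernel_survival (X i \<omega>) (ln x) \<sigma>)
      = D.expectation (\<lambda>t. lognormal_kernel_survival t (ln x) \<sigma>)"
    by (subst integral_distr) auto
  also have "\<dots> = (\<integral>z. cdf (distr M borel (X i)) (x * exp (\<sigma> * z)) \<partial>std_normal_distribution)"
  proof (rule D.integral_measure_less[OF prob_space_std_normal _ cont])
    show "AE t in distr M borel (X i). lognormal_kernel_survival t (ln x) \<sigma> = measure std_normal_distribution {z \<in> space std_normal_distribution. t < x * exp (\<sigma> * z)}"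
      using pos by eventually_elim (rule kernel_eq_measure(1)[OF _ assms(2,3)])
  qed simp_all
  also have "\<dots> = sm \<sigma> x"
    by (simp add: smooth_def cdf)
  finally show "expectation (\<lambda>\<omega>. lognormal_kernel_survival (X i \<omega>) (ln x) \<sigma>) = sm \<sigma> x" .
  have "expectation (\<lambda>\<omega>. (lognormal_kernel_survival (X i \<omega>) (ln x) \<sigma>)\<^sup>2)
      = D.expectation (\<lambda>t. (lognormal_kernel_survival t (ln x) \<sigma>)\<^sup>2)"
    by (subst integral_distr) auto
  also have "\<dots> = (\<integral>p. cdf (distr M borel (X i)) (x * exp (\<sigma> * min (fst p) (snd p))) \<partial>std_normal_pair)"
  proof (rule D.integral_measure_less[OF prob_space_std_normal_pair _ cont])
    show "AE t in distr M borel (X i). (lognormal_kernel_survival t (ln x) \<sigma>)\<^sup>2 = measure std_normal_pair {p \<in> space std_normal_pair. t < x * exp (\<sigma> * min (fst p) (snd p))}"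
      using pos by eventually_elim (rule kernel_eq_measure(2)[OF _ assms(2,3)])
  qed simp_all
  also have "\<dots> = sm_min \<sigma> x"
    by (simp add: smooth_def cdf)
  finally show "expectation (\<lambda>\<omega>. (lognormal_kernel_survival (X i \<omega>) (ln x) \<sigma>)\<^sup>2) = sm_min \<sigma> x" .
qed

lemma LN_estimator_bounds: "0 \<le> LN_estimator X n b \<omega> x" "LN_estimator X n b \<omega> x \<le> 1"
proof -
  have "0 \<le> (\<Sum>i=1..n. lognormal_kernel_survival (X i \<omega>) (ln x) (sqrt b))"
    by (rule sum_nonneg[OF kernel_bounds(1)])
  then show "0 \<le> LN_estimator X n b \<omega> x"
    by (simp add: LN_estimator_def)
  have "(\<Sum>i=1..n. lognormal_kernel_survival (X i \<omega>) (ln x) (sqrt b)) \<le> (\<Sum>i=1..n. 1)"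
    by (intro sum_mono kernel_bounds)
  then show "LN_estimator X n b \<omega> x \<le> 1"
    by (cases "n = 0") (auto simp: LN_estimator_def field_simps)
qed

lemma LN_estimator_measurable [measurable]:
  "(\<lambda>(\<omega>, x). LN_estimator X n b \<omega> x) \<in> borel_measurable (M \<Otimes>\<^sub>M borel)"
  "(\<lambda>\<omega>. LN_estimator X n b \<omega> x) \<in> borel_measurable M"
proof -
  note [measurable] = X_measurable
  show "(\<lambda>(\<omega>, x). LN_estimator X n b \<omega> x) \<in> borel_measurable (M \<Otimes>\<^sub>M borel)"
    unfolding LN_estimator_def case_prod_unfold
    by (intro borel_measurable_times borel_measurable_sum kernel_measurable measurable_compose[OF measurable_fst X_measurable]) auto
  show "(\<lambda>\<omega>. LN_estimator X n b \<omega> x) \<in> borel_measurable M"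
    unfolding LN_estimator_def
    by (intro borel_measurable_times borel_measurable_sum kernel_measurable X_measurable) auto
qed

lemma LN_estimator_integrable:
  "integrable M (\<lambda>\<omega>. LN_estimator X n b \<omega> x)" "integrable M (\<lambda>\<omega>. (LN_estimator X n b \<omega> x)\<^sup>2)"
proof -
  have *: "\<bar>LN_estimator X n b \<omega> x\<bar> \<le> 1" for \<omega>
    using LN_estimator_bounds by (simp add: abs_of_nonneg)
  show "integrable M (\<lambda>\<omega>. LN_estimator X n b \<omega> x)"
    by (rule integrable_const_bound[where B = 1]) (simp_all add: *)
  show "integrable M (\<lambda>\<omega>. (LN_estimator X n b \<omega> x)\<^sup>2)"
    by (rule integrable_const_bound[where B = 1]) (simp_all add: * abs_square_le_1)
qed

lemma LN_estimator_moments: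
  assumes "1 \<le> n" "0 < x" "0 < b"
  shows "expectation (\<lambda>\<omega>. LN_estimator X n b \<omega> x) = sm (sqrt b) x"
    and "variance (\<lambda>\<omega>. LN_estimator X n b \<omega> x) = (sm_min (sqrt b) x - (sm (sqrt b) x)\<^sup>2) / real n"
proof -
  define Y where "Y i \<omega> = lognormal_kernel_survival (X i \<omega>) (ln x) (sqrt b)" for i \<omega>
  define S where "S \<omega> = (\<Sum>i=1..n. Y i \<omega>)" for \<omega>
  have Y: "integrable M (Y i)" "integrable M (\<lambda>\<omega>. (Y i \<omega>)\<^sup>2)" if "1 \<le> i" for i
  proof -
    note [measurable] = X_measurable[OF that]
    show "integrable M (Y i)"
      unfolding Y_def by (rule integrable_const_bound[where B = 1]) (auto simp: kernel_bounds)
    show "integrable M (\<lambda>\<omega>. (Y i \<omega>)\<^sup>2)"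
      unfolding Y_def by (rule integrable_const_bound[where B = 1]) (auto simp: kernel_bounds abs_square_le_1)
  qed
  have Y_moments: "expectation (Y i) = sm (sqrt b) x" "expectation (\<lambda>\<omega>. (Y i \<omega>)\<^sup>2) = sm_min (sqrt b) x" if "1 \<le> i" for i
    using kernel_moments[OF that assms(2), of "sqrt b"] assms(3) by (simp_all add: Y_def[abs_def])
  have eq: "LN_estimator X n b \<omega> x = S \<omega> / real n" for \<omega>
    by (simp add: LN_estimator_def S_def Y_def)
  have ES: "expectation S = real n * sm (sqrt b) x"
    unfolding S_def using Y Y_moments by (simp add: Bochner_Integration.integral_sum)
  then show "expectation (\<lambda>\<omega>. LN_estimator X n b \<omega> x) = sm (sqrt b) x"
    unfolding eq using assms(1) by simp
  have "indep_vars (\<lambda>_. borel) (\<lambda>i \<omega>. lognormal_kernel_survival (X i \<omega>) (ln x) (sqrt b)) {1..n}"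
    by (rule indep_vars_compose2[OF indep_vars_subset[OF indep]]) auto
  then have "indep_vars (\<lambda>_. borel) Y {1..n}"
    by (simp add: Y_def[abs_def])
  then have "variance S = (\<Sum>i=1..n. variance (Y i))"
    unfolding S_def using variance_sum_indep[of "{1..n}" Y] Y by auto
  also have "\<dots> = real n * (sm_min (sqrt b) x - (sm (sqrt b) x)\<^sup>2)"
  proof -
    have "variance (Y i) = sm_min (sqrt b) x - (sm (sqrt b) x)\<^sup>2" if "1 \<le> i" for i
      using variance_eq[OF Y[OF that]] Y_moments[OF that] by simp
    then have "(\<Sum>i=1..n. variance (Y i)) = (\<Sum>i=1..n. sm_min (sqrt b) x - (sm (sqrt b) x)\<^sup>2)"
      by (intro sum.cong) auto
    then show ?thesis
      by simp
  qed
  finally have "variance S / (real n)\<^sup>2 = (sm_min (sqrt b) x - (sm (sqrt b) x)\<^sup>2) / real n"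
    using assms(1) by (simp only:) (simp add: power2_eq_square[of "real n"])
  moreover have "variance (\<lambda>\<omega>. S \<omega> / real n) = variance S / (real n)\<^sup>2"
    by (simp add: power_divide flip: diff_divide_distrib)
  ultimately show "variance (\<lambda>\<omega>. LN_estimator X n b \<omega> x) = (sm_min (sqrt b) x - (sm (sqrt b) x)\<^sup>2) / real n"
    unfolding eq by (simp only:)
qed

text \<open>Tonelli exchanges expectation and integral over \<open>x\<close> in
  \<open>ennreal\<close>, and at each \<open>x\<close> the mean square error splits into variance
  and squared bias. Finiteness comes afterwards from the integrability of both parts. The sign in
  the last claim is what later allows \<open>enn2real\<close> to undo
  \<open>ennreal\<close>.\<close>

lemma MISE_LN_estimator:
  assumes n: "1 \<le> n" and b: "0 < b"
  shows "MISE M F (LN_estimator X n b)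
      = (\<integral>\<^sup>+x\<in>{0<..}. ennreal (variance (\<lambda>\<omega>. LN_estimator X n b \<omega> x)) \<partial>lborel)
        + (\<integral>\<^sup>+x\<in>{0<..}. ennreal ((bias M F (LN_estimator X n b) x)\<^sup>2) \<partial>lborel)"
    and "MISE M F (LN_estimator X n b)
      = ennreal ((\<integral>x. sm_min (sqrt b) x - (sm (sqrt b) x)\<^sup>2 \<partial>lborel) / real n
          + (\<integral>x. (sm (sqrt b) x - F x)\<^sup>2 \<partial>lborel))"
    and "0 \<le> (\<integral>x. sm_min (sqrt b) x - (sm (sqrt b) x)\<^sup>2 \<partial>lborel)"
proof -
  interpret pair_sigma_finite M lborel ..
  let ?V = "\<lambda>x. (sm_min (sqrt b) x - (sm (sqrt b) x)\<^sup>2) / real n"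
  let ?B = "\<lambda>x. (sm (sqrt b) x - F x)\<^sup>2"
  \<comment> \<open>The sign is read off from the variance that this expression equals for positive
    \<open>x\<close>; for other \<open>x\<close> it is 0.\<close>
  have V0: "0 \<le> ?V x" for x
  proof (cases "0 < x")
    case True
    then show ?thesis
      using LN_estimator_moments(2)[OF n True b] variance_positive[of "\<lambda>\<omega>. LN_estimator X n b \<omega> x"] by simp
  qed (simp add: smooth_nonpos)
  have iV: "integrable lborel ?V" and iB: "integrable lborel ?B"
    using integrable_sm_variance[of "sqrt b"] integrable_sm_bias_power2[of "sqrt b"] by auto
  have V: "(\<integral>\<^sup>+x\<in>{0<..}. ennreal (variance (\<lambda>\<omega>. LN_estimator X n b \<omega> x)) \<partial>lborel) = (\<integral>\<^sup>+x. ?V x \<partial>lborel)"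
  proof (rule nn_integral_cong)
    show "ennreal (variance (\<lambda>\<omega>. LN_estimator X n b \<omega> x)) * indicator {0<..} x = ennreal (?V x)" for x
      using LN_estimator_moments(2)[OF n _ b, of x] by (cases "0 < x") (simp_all add: smooth_nonpos)
  qed
  have B: "(\<integral>\<^sup>+x\<in>{0<..}. ennreal ((bias M F (LN_estimator X n b) x)\<^sup>2) \<partial>lborel) = (\<integral>\<^sup>+x. ?B x \<partial>lborel)"
    using n b by (intro nn_integral_cong) (auto simp: indicator_def bias_def LN_estimator_moments smooth_nonpos F_nonpos)
  have [measurable]: "(\<lambda>p. LN_estimator X n b (fst p) (snd p)) \<in> borel_measurable (M \<Otimes>\<^sub>M lborel)"
    using LN_estimator_measurable(1)[of n b] by (simp add: case_prod_unfold cong: measurable_cong_sets)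
  have "MISE M F (LN_estimator X n b)
      = (\<integral>\<^sup>+x. \<integral>\<^sup>+\<omega>. ennreal ((LN_estimator X n b \<omega> x - F x)\<^sup>2) * indicator {0<..} x \<partial>M \<partial>lborel)"
    unfolding MISE_def by (rule Fubini'[symmetric]) measurable
  also have "\<dots> = (\<integral>\<^sup>+x. ennreal (?V x) + ennreal (?B x) \<partial>lborel)"
  proof (rule nn_integral_cong)
    fix x :: real
    show "(\<integral>\<^sup>+\<omega>. ennreal ((LN_estimator X n b \<omega> x - F x)\<^sup>2) * indicator {0<..} x \<partial>M) = ennreal (?V x) + ennreal (?B x)"
    proof (cases "0 < x")
      case True
      have "integrable M (\<lambda>\<omega>. (LN_estimator X n b \<omega> x - F x)\<^sup>2)"
        using LN_estimator_integrable[of n b x] by (simp add: power2_diff)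
      then have "(\<integral>\<^sup>+\<omega>. ennreal ((LN_estimator X n b \<omega> x - F x)\<^sup>2) \<partial>M)
          = ennreal (expectation (\<lambda>\<omega>. (LN_estimator X n b \<omega> x - F x)\<^sup>2))"
        by (rule nn_integral_eq_integral) simp
      also have "\<dots> = ennreal (?V x + ?B x)"
        using mean_square_error[OF LN_estimator_integrable, of n b x "F x"] LN_estimator_moments[OF n True b] by simp
      finally show ?thesis
        using True V0[of x] by (simp add: ennreal_plus)
    qed (simp add: smooth_nonpos F_nonpos)
  qed
  also have "\<dots> = (\<integral>\<^sup>+x. ?V x \<partial>lborel) + (\<integral>\<^sup>+x. ?B x \<partial>lborel)"
    by (intro nn_integral_add) auto
  finally have *: "MISE M F (LN_estimator X n b) = (\<integral>\<^sup>+x. ?V x \<partial>lborel) + (\<integral>\<^sup>+x. ?B x \<partial>lborel)" .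
  then show "MISE M F (LN_estimator X n b)
      = (\<integral>\<^sup>+x\<in>{0<..}. ennreal (variance (\<lambda>\<omega>. LN_estimator X n b \<omega> x)) \<partial>lborel)
        + (\<integral>\<^sup>+x\<in>{0<..}. ennreal ((bias M F (LN_estimator X n b) x)\<^sup>2) \<partial>lborel)"
    by (simp only: V B)
  have V_int: "0 \<le> (\<integral>x. ?V x \<partial>lborel)"
    using V0 by (intro integral_nonneg_AE) auto
  then show "0 \<le> (\<integral>x. sm_min (sqrt b) x - (sm (sqrt b) x)\<^sup>2 \<partial>lborel)"
    using n by (simp add: zero_le_divide_iff)
  have "(\<integral>\<^sup>+x. ?V x \<partial>lborel) = ennreal (\<integral>x. ?V x \<partial>lborel)" "(\<integral>\<^sup>+x. ?B x \<partial>lborel) = ennreal (\<integral>x. ?B x \<partial>lborel)"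
    by (rule nn_integral_eq_integral[OF iV], use V0 in simp) (rule nn_integral_eq_integral[OF iB], simp)
  then have "MISE M F (LN_estimator X n b) = ennreal ((\<integral>x. ?V x \<partial>lborel) + (\<integral>x. ?B x \<partial>lborel))"
    using V_int by (simp add: * ennreal_plus)
  then show "MISE M F (LN_estimator X n b)
      = ennreal ((\<integral>x. sm_min (sqrt b) x - (sm (sqrt b) x)\<^sup>2 \<partial>lborel) / real n
          + (\<integral>x. (sm (sqrt b) x - F x)\<^sup>2 \<partial>lborel))"
    by simp
qed

end

section \<open>Expansion of the MISE for small bandwidths\<close>

text \<open>The sequential limits were obtained for sequences within the interval from 0 to 1. A
  one-sided filter limit sees only small \<open>\<sigma>\<close>, and so can be composed with a
  bandwidth sequence that starts with large or, at index 0, arbitrary values.\<close>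

lemma (in dilation_smooth_cdf) integrated_variance_at_right:
  "((\<lambda>\<sigma>. ((\<integral>x. sm_min \<sigma> x - (sm \<sigma> x)\<^sup>2 \<partial>lborel) - (\<integral>x. F x * (1 - F x) \<partial>lborel)) / \<sigma>)
    \<longlongrightarrow> - mean / sqrt pi) (at_right 0)"
  and integrated_bias_at_right:
  "((\<lambda>\<sigma>. (\<integral>x. (sm \<sigma> x - F x)\<^sup>2 \<partial>lborel) / \<sigma> ^ 4) \<longlongrightarrow> (\<integral>x. (h x)\<^sup>2 / 4 \<partial>lborel)) (at_right 0)"
proof -
  have 1: "0 < S i" "S i \<le> 1" if "\<forall>i. S i \<in> {0<..1} - {0}" for S :: "nat \<Rightarrow> real" and i
    using that by (auto simp: greaterThanAtMost_iff)
  have *: "at_right 0 = at 0 within {0<..1::real}"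
    by (rule at_within_nhd[of _ "{..<1}"]) auto
  show "((\<lambda>\<sigma>. ((\<integral>x. sm_min \<sigma> x - (sm \<sigma> x)\<^sup>2 \<partial>lborel) - (\<integral>x. F x * (1 - F x) \<partial>lborel)) / \<sigma>)
    \<longlongrightarrow> - mean / sqrt pi) (at_right 0)"
    unfolding * tendsto_at_iff_sequentially comp_def
    by (intro allI impI integrated_variance_tendsto) (auto dest: 1)
  show "((\<lambda>\<sigma>. (\<integral>x. (sm \<sigma> x - F x)\<^sup>2 \<partial>lborel) / \<sigma> ^ 4) \<longlongrightarrow> (\<integral>x. (h x)\<^sup>2 / 4 \<partial>lborel)) (at_right 0)"
    unfolding * tendsto_at_iff_sequentially comp_def
    by (intro allI impI integrated_bias_tendsto) (auto dest: 1)
qed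

context LN_sample
begin

text \<open>The remainders are explicit, and divided by their scales they depend on \<open>n\<close>
  only through \<open>b n\<close>, for large \<open>n\<close>; each o-term is therefore one of the
  limits at 0 composed with \<open>sqrt (b n)\<close>. Finiteness of the MISE is recorded because
  \<open>enn2real\<close> would send an infinite value to 0.\<close>

lemma MISE_expansion:
  fixes b :: "nat \<Rightarrow> real"
  defines "R1 \<equiv> \<lambda>n. (1 / real n) * ((\<integral>x. sm_min (sqrt (b n)) x - (sm (sqrt (b n)) x)\<^sup>2 \<partial>lborel)
      - (\<integral>x. F x * (1 - F x) \<partial>lborel) + sqrt (b n) * (mean / sqrt pi))"
    and "R2 \<equiv> \<lambda>n. (\<integral>x. (sm (sqrt (b n)) x - F x)\<^sup>2 \<partial>lborel) - (b n)\<^sup>2 * (\<integral>x. (h x)\<^sup>2 / 4 \<partial>lborel)"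
  assumes b_pos: "\<And>n. 1 \<le> n \<Longrightarrow> 0 < b n" and b_lim: "b \<longlonglongrightarrow> 0"
  shows "R1 \<in> o(\<lambda>n. (1 / real n) * sqrt (b n))" and "R2 \<in> o(\<lambda>n. (b n)\<^sup>2)"
    and "\<And>n. 1 \<le> n \<Longrightarrow> enn2real (MISE M F (LN_estimator X n (b n))) =
      (1 / real n) * (\<integral>x. F x * (1 - F x) \<partial>lborel) - (1 / real n) * sqrt (b n) * (mean / sqrt pi)
      + (b n)\<^sup>2 * (\<integral>x. (h x)\<^sup>2 / 4 \<partial>lborel) + R1 n + R2 n"
    and "\<And>n. 1 \<le> n \<Longrightarrow> MISE M F (LN_estimator X n (b n)) < \<infinity>"
proof -
  let ?V = "\<lambda>\<sigma>. \<integral>x. sm_min \<sigma> x - (sm \<sigma> x)\<^sup>2 \<partial>lborel"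
  let ?B = "\<lambda>\<sigma>. \<integral>x. (sm \<sigma> x - F x)\<^sup>2 \<partial>lborel"
  let ?A = "\<integral>x. F x * (1 - F x) \<partial>lborel"
  let ?C = "\<integral>x. (h x)\<^sup>2 / 4 \<partial>lborel"
  \<comment> \<open>Index 0 has to be left out: \<open>b 0\<close> is unconstrained and
    \<open>1 / real 0\<close> is 0.\<close>
  have pos: "\<forall>\<^sub>F n in sequentially. 0 < b n \<and> 0 < n"
    using eventually_gt_at_top[of 0] by eventually_elim (simp add: b_pos)
  have "(\<lambda>n. sqrt (b n)) \<longlonglongrightarrow> 0"
    using tendsto_real_sqrt[OF b_lim] by simp
  then have lim: "filterlim (\<lambda>n. sqrt (b n)) (at_right 0) sequentially"
    using pos by (auto simp: filterlim_at elim: eventually_mono)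
  have "(\<lambda>n. (?V (sqrt (b n)) - ?A) / sqrt (b n) + mean / sqrt pi) \<longlonglongrightarrow> - mean / sqrt pi + mean / sqrt pi"
    by (intro tendsto_add tendsto_const filterlim_compose[OF integrated_variance_at_right lim])
  then have "(\<lambda>n. (?V (sqrt (b n)) - ?A) / sqrt (b n) + mean / sqrt pi) \<longlonglongrightarrow> 0"
    by simp
  moreover have "\<forall>\<^sub>F n in sequentially. (?V (sqrt (b n)) - ?A) / sqrt (b n) + mean / sqrt pi
      = R1 n / ((1 / real n) * sqrt (b n))"
    using pos by eventually_elim (simp add: R1_def field_simps)
  ultimately have "(\<lambda>n. R1 n / ((1 / real n) * sqrt (b n))) \<longlonglongrightarrow> 0"
    by (rule Lim_transform_eventually)
  then show "R1 \<in> o(\<lambda>n. (1 / real n) * sqrt (b n))"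
    using pos by (intro smalloI_tendsto) (auto elim: eventually_mono)
  have "(\<lambda>n. ?B (sqrt (b n)) / sqrt (b n) ^ 4 - ?C) \<longlonglongrightarrow> ?C - ?C"
    by (intro tendsto_diff tendsto_const filterlim_compose[OF integrated_bias_at_right lim])
  then have "(\<lambda>n. ?B (sqrt (b n)) / sqrt (b n) ^ 4 - ?C) \<longlonglongrightarrow> 0"
    by simp
  moreover have "\<forall>\<^sub>F n in sequentially. ?B (sqrt (b n)) / sqrt (b n) ^ 4 - ?C = R2 n / (b n)\<^sup>2"
    using pos
  proof eventually_elim
    case (elim n)
    have "sqrt (b n) ^ 4 = (sqrt (b n) ^ 2) ^ 2"
      by (simp flip: power_mult)
    then have "sqrt (b n) ^ 4 = (b n)\<^sup>2"
      using elim by simp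
    then show ?case
      using elim by (simp only: R2_def) (simp add: diff_divide_distrib)
  qed
  ultimately have "(\<lambda>n. R2 n / (b n)\<^sup>2) \<longlonglongrightarrow> 0"
    by (rule Lim_transform_eventually)
  then show "R2 \<in> o(\<lambda>n. (b n)\<^sup>2)"
    using pos by (intro smalloI_tendsto) (auto elim: eventually_mono)
  fix n :: nat assume n: "1 \<le> n"
  show "MISE M F (LN_estimator X n (b n)) < \<infinity>"
    unfolding MISE_LN_estimator(2)[OF n b_pos[OF n]] by simp
  have "0 \<le> ?B (sqrt (b n))"
    by simp
  then have "enn2real (MISE M F (LN_estimator X n (b n))) = ?V (sqrt (b n)) / real n + ?B (sqrt (b n))"
    unfolding MISE_LN_estimator(2)[OF n b_pos[OF n]]
    using MISE_LN_estimator(3)[OF n b_pos[OF n]] by (intro enn2real_ennreal add_nonneg_nonneg divide_nonneg_nonneg) auto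
  then show "enn2real (MISE M F (LN_estimator X n (b n))) =
      (1 / real n) * ?A - (1 / real n) * sqrt (b n) * (mean / sqrt pi) + (b n)\<^sup>2 * ?C + R1 n + R2 n"
    by (simp add: R1_def R2_def algebra_simps)
qed

end

section \<open>Minimization of the expansion\<close>

text \<open>At its critical point \<open>s0\<close> the quartic minus its value has a double root.
  The cofactor is \<open>(s + s0)\<^sup>2 + 2 * s0\<^sup>2\<close>, so positivity, and with it
  uniqueness of the minimizer, can be read off without calculus.\<close>

lemma quartic_minus_linear_eq:
  fixes s s0 C :: real
  shows "C * s ^ 4 - 4 * C * s0 ^ 3 * s + 3 * C * s0 ^ 4 = C * (s - s0)\<^sup>2 * (s\<^sup>2 + 2 * s * s0 + 3 * s0\<^sup>2)"
  by (simp add: algebra_simps power2_eq_square power3_eq_cube power4_eq_xxxx)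

text \<open>
  In \<open>s = b\<^sup>1\<^sup>/\<^sup>2\<close> the criterion is \<open>C s\<^sup>4 - (V / n) s\<close> up to a constant, with critical point
  \<open>s\<^sub>0 = (V / (4 n C))\<^sup>1\<^sup>/\<^sup>3\<close>.
\<close>

lemma LN_AMISE_minimizer:
  fixes f f' :: "real \<Rightarrow> real"
  defines "V \<equiv> LN_var_const f" and "C \<equiv> LN_bias_const f f'"
  assumes V: "0 < V" and C: "0 < C" and n: "1 \<le> n"
  defines "s0 \<equiv> (V / (4 * real n * C)) powr (1 / 3)"
  shows "0 < s0" and "LN_b_opt f f' n = s0\<^sup>2"
    and "LN_AMISE F f f' n (s0\<^sup>2) = (1 / real n) * (LBINT x:{0<..}. F x * (1 - F x))
       - real n powr (- 4 / 3) * (3 / 4) * (V ^ 4 / (4 * C)) powr (1 / 3)"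
    and "is_arg_min (LN_AMISE F f f' n) (\<lambda>c. c > 0) c \<longleftrightarrow> c = LN_b_opt f f' n"
proof -
  let ?A = "LBINT x:{0<..}. F x * (1 - F x)"
  have n': "0 < real n"
    using n by simp
  show s0: "0 < s0"
    using V C n' by (simp add: s0_def)
  have s0_eq: "s0 = real n powr (- 1 / 3) * V powr (1 / 3) * (4 * C) powr (- 1 / 3)"
  proof -
    have "V / (4 * real n * C) = real n powr (- 1) * V powr 1 * (4 * C) powr (- 1)"
      using V C n' by (simp add: powr_minus field_simps)
    then have "s0 = (real n powr (- 1) * V powr 1 * (4 * C) powr (- 1)) powr (1 / 3)"
      by (simp only: s0_def)
    also have "\<dots> = (real n powr (- 1)) powr (1 / 3) * (V powr 1) powr (1 / 3) * ((4 * C) powr (- 1)) powr (1 / 3)"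
      using V C n' by (simp only: powr_mult powr_ge_zero mult_nonneg_nonneg)
    finally show ?thesis
      by (simp only: powr_powr) simp
  qed
  have s0_powr: "s0 powr a = real n powr (- a / 3) * V powr (a / 3) * (4 * C) powr (- a / 3)" for a
    unfolding s0_eq using V C n' by (simp add: powr_mult powr_powr)
  have "s0\<^sup>2 = s0 powr 2"
    using s0 by simp
  also have "\<dots> = real n powr (- 2 / 3) * (V powr (2 / 3) * (4 * C) powr (- 2 / 3))"
    by (simp add: s0_powr)
  also have "V powr (2 / 3) * (4 * C) powr (- 2 / 3) = (4 * C / V) powr (- 2 / 3)"
    using V C by (simp add: powr_divide powr_minus field_simps)
  finally show b_opt: "LN_b_opt f f' n = s0\<^sup>2"
    by (simp add: LN_b_opt_def V_def C_def)
  \<comment> \<open>The critical point equation; it rewrites the linear coefficient into the shape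
    of \<open>quartic_minus_linear_eq\<close>.\<close>
  have cube: "V / real n = 4 * C * s0 ^ 3"
  proof -
    have "s0 ^ 3 = s0 powr 3"
      using s0 by simp
    also have "\<dots> = V / (4 * real n * C)"
      using V C n' by (simp add: s0_powr powr_minus field_simps)
    finally show ?thesis
      using C n' by (simp add: field_simps)
  qed
  have AMISE: "LN_AMISE F f f' n (s\<^sup>2) = ?A / real n - 3 * C * s0 ^ 4 + C * (s - s0)\<^sup>2 * (s\<^sup>2 + 2 * s * s0 + 3 * s0\<^sup>2)"
    if "0 < s" for s
  proof -
    have "LN_AMISE F f f' n (s\<^sup>2) = ?A / real n - (V / real n) * s + C * s ^ 4"
      using that by (simp add: LN_AMISE_def V_def C_def ac_simps flip: power_mult)
    then show ?thesis
      unfolding cube quartic_minus_linear_eq[symmetric] by simp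
  qed
  \<comment> \<open>The minimum lies \<open>3 * C * s0 ^ 4\<close> below the constant term, so this
    1/4 produces the factor 3/4.\<close>
  have "C * s0 ^ 4 = (1 / 4) * (real n powr (- 4 / 3) * (V ^ 4 / (4 * C)) powr (1 / 3))"
  proof -
    have "s0 ^ 4 = s0 powr 4"
      using s0 by simp
    also have "\<dots> = real n powr (- 4 / 3) * V powr (4 / 3) * (4 * C) powr (- 4 / 3)"
      by (simp add: s0_powr)
    finally have "C * s0 ^ 4 = (1 / 4) * (real n powr (- 4 / 3) * (V powr (4 / 3) * ((4 * C) powr 1 * (4 * C) powr (- 4 / 3))))"
      using C by simp
    also have "(4 * C) powr 1 * (4 * C) powr (- 4 / 3) = (4 * C) powr (- (1 / 3))"
      by (subst powr_add[symmetric]) simp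
    also have "V powr (4 / 3) * (4 * C) powr (- (1 / 3)) = (V ^ 4 / (4 * C)) powr (1 / 3)"
    proof -
      have "(V ^ 4) powr (1 / 3) = (V powr 4) powr (1 / 3)"
        using V by simp
      also have "\<dots> = V powr (4 / 3)"
        by (simp only: powr_powr) simp
      finally show ?thesis
        using V C by (simp add: powr_divide powr_minus_divide)
    qed
    finally show ?thesis .
  qed
  then show "LN_AMISE F f f' n (s0\<^sup>2) = (1 / real n) * ?A
       - real n powr (- 4 / 3) * (3 / 4) * (V ^ 4 / (4 * C)) powr (1 / 3)"
    using AMISE[OF s0] by simp
  have le: "LN_AMISE F f f' n (s0\<^sup>2) \<le> LN_AMISE F f f' n (s\<^sup>2)" if "0 < s" for s
    unfolding AMISE[OF that] AMISE[OF s0] using C s0 that by simp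
  have less: "LN_AMISE F f f' n (s0\<^sup>2) < LN_AMISE F f f' n (s\<^sup>2)" if "0 < s" "s \<noteq> s0" for s
  proof -
    have "0 < C * (s - s0)\<^sup>2 * (s\<^sup>2 + 2 * s * s0 + 3 * s0\<^sup>2)"
      using C s0 that by (intro mult_pos_pos add_pos_pos) auto
    then show ?thesis
      unfolding AMISE[OF that(1)] AMISE[OF s0] by simp
  qed
  show "is_arg_min (LN_AMISE F f f' n) (\<lambda>c. c > 0) c \<longleftrightarrow> c = LN_b_opt f f' n"
  proof
    assume c: "is_arg_min (LN_AMISE F f f' n) (\<lambda>c. c > 0) c"
    then have "0 < c" "\<not> LN_AMISE F f f' n (s0\<^sup>2) < LN_AMISE F f f' n c"
      using s0 by (auto simp: is_arg_min_def)
    then have "sqrt c = s0"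
      using less[of "sqrt c"] by auto
    then show "c = LN_b_opt f f' n"
      using \<open>0 < c\<close> by (auto simp: b_opt)
  next
    assume c: "c = LN_b_opt f f' n"
    have "LN_AMISE F f f' n c \<le> LN_AMISE F f f' n y" if "0 < y" for y
      using le[of "sqrt y"] that by (simp add: c b_opt)
    then show "is_arg_min (LN_AMISE F f f' n) (\<lambda>c. c > 0) c"
      unfolding is_arg_min_def using s0 c b_opt by (metis leD zero_less_power)
  qed
qed

lemma tendsto_LN_b_opt: "(\<lambda>n. LN_b_opt f f' n) \<longlonglongrightarrow> 0"
proof -
  have "(\<lambda>n. real n powr (- 2 / 3)) \<longlonglongrightarrow> 0"
    by (intro tendsto_neg_powr filterlim_real_sequentially) simp
  then show ?thesis
    unfolding LN_b_opt_def by (rule tendsto_mult_left_zero)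
qed

section \<open>From a twice differentiable c.d.f. to the analytic conditions\<close>

text \<open>Write \<open>1 - F x\<close> as the integral of \<open>f\<close> beyond \<open>x\<close>
  and exchange the integrals over \<open>0 < x \<le> t\<close>: each \<open>t\<close> then counts
  with the length \<open>t\<close>. Positivity of the first moment is needed for the division by
  \<open>LN_var_const f\<close> in the optimal bandwidth.\<close>

lemma survival_integral_of_density:
  fixes F f f' :: "real \<Rightarrow> real" and D :: "real measure"
  assumes D: "real_distribution D" and cdf: "cdf D = F"
    and support: "\<And>x. x \<le> 0 \<Longrightarrow> F x = 0"
    and deriv1: "\<And>x. x > 0 \<Longrightarrow> (F has_real_derivative f x) (at x)"
    and deriv2: "\<And>x. x > 0 \<Longrightarrow> (f has_real_derivative f' x) (at x)"
    and int1: "set_integrable lborel {0<..} (\<lambda>x. x * f x)"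
  shows "has_bochner_integral lborel (\<lambda>x. indicator {0<..} x * (1 - F x)) (LBINT x:{0<..}. x * f x)"
    and "0 < (LBINT x:{0<..}. x * f x)"
proof -
  interpret D: real_distribution D by fact
  have mono: "mono F"
    unfolding cdf[symmetric] by (intro monoI D.cdf_nondecreasing)
  have [measurable]: "F \<in> borel_measurable borel"
    using mono by (rule borel_measurable_mono)
  have F_le_1: "F x \<le> 1" for x
    unfolding cdf[symmetric] by (rule D.cdf_bounded_prob)
  have F_lim: "(F \<longlongrightarrow> 1) at_top"
    using D.cdf_lim_at_top_prob by (simp add: cdf)
  have f_nonneg: "0 \<le> f x" if "0 < x" for x
    using mono_on_imp_deriv_nonneg[of UNIV F "f x" x] mono deriv1[OF that] by simp
  define k where "k x = indicator {0<..} x *\<^sub>R f x" for x :: real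
  have [measurable]: "k \<in> borel_measurable borel"
    unfolding k_def using deriv2
    by (intro borel_measurable_continuous_on_indicator) (auto intro!: continuous_at_imp_continuous_on DERIV_isCont)
  have k_nonneg: "0 \<le> k x" for x
    using f_nonneg[of x] by (simp add: k_def indicator_def)
  have survival: "ennreal (indicator {0<..} x * (1 - F x)) = (\<integral>\<^sup>+t. ennreal (k t) * indicator {0<..t} x \<partial>lborel)" for x
  proof (cases "0 < x")
    case True
    have "(\<integral>\<^sup>+t. ennreal (k t) * indicator {x..} t \<partial>lborel) = ennreal (1 - F x)"
    proof (rule nn_integral_FTC_atLeast[OF _ _ k_nonneg F_lim])
      show "(F has_real_derivative k t) (at t)" if "x \<le> t" for t
        using deriv1[of t] True that by (simp add: k_def)
    qed simp
    moreover have "indicator {x..} t = (indicator {0<..t} x :: ennreal)" for t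
      using True by (auto simp: indicator_def)
    ultimately show ?thesis
      using True by simp
  qed simp
  \<comment> \<open>The conditional is the Lebesgue measure of \<open>{0<..t}\<close>.\<close>
  have k_eq: "ennreal (k t) * ennreal (if 0 \<le> t then t else 0) = ennreal (indicator {0<..} t * (t * f t))" for t
    using f_nonneg[of t] by (auto simp: k_def indicator_def mult.commute simp flip: ennreal_mult)
  have i: "integrable lborel (\<lambda>x. indicator {0<..} x * (x * f x))"
    using int1 by (simp add: set_integrable_def)
  have I: "(LBINT x:{0<..}. x * f x) = (\<integral>x. indicator {0<..} x * (x * f x) \<partial>lborel)"
    by (simp add: set_lebesgue_integral_def)
  have i_nonneg: "0 \<le> indicator {0<..} x * (x * f x)" for x
    using f_nonneg[of x] by (simp add: indicator_def)
  have [measurable]: "Measurable.pred (borel \<Otimes>\<^sub>M borel) (\<lambda>p. fst p \<in> {0<..snd p :: real})"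
    by simp
  have "(\<integral>\<^sup>+x. ennreal (indicator {0<..} x * (1 - F x)) \<partial>lborel)
      = (\<integral>\<^sup>+x. \<integral>\<^sup>+t. ennreal (k t) * indicator {0<..t} x \<partial>lborel \<partial>lborel)"
    by (simp only: survival)
  also have "\<dots> = (\<integral>\<^sup>+t. \<integral>\<^sup>+x. ennreal (k t) * indicator {0<..t} x \<partial>lborel \<partial>lborel)"
    by (rule lborel_pair.Fubini') (simp add: indicator_def case_prod_unfold)
  also have "\<dots> = (\<integral>\<^sup>+t. ennreal (k t) * ennreal (if 0 \<le> t then t else 0) \<partial>lborel)"
    by (intro nn_integral_cong) (simp add: nn_integral_cmult)
  also have "\<dots> = (\<integral>\<^sup>+t. ennreal (indicator {0<..} t * (t * f t)) \<partial>lborel)"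
    by (simp only: k_eq)
  also have "\<dots> = ennreal (LBINT x:{0<..}. x * f x)"
    unfolding I using i i_nonneg by (intro nn_integral_eq_integral) auto
  finally have *: "(\<integral>\<^sup>+x. ennreal (indicator {0<..} x * (1 - F x)) \<partial>lborel) = \<dots>" .
  have I_nonneg: "0 \<le> (LBINT x:{0<..}. x * f x)"
    unfolding I using i_nonneg by (intro integral_nonneg_AE) auto
  show survival_integral:
    "has_bochner_integral lborel (\<lambda>x. indicator {0<..} x * (1 - F x)) (LBINT x:{0<..}. x * f x)"
    using * I_nonneg F_le_1 by (intro has_bochner_integral_nn_integral) auto
  \<comment> \<open>Since \<open>F 0 = 0\<close>, right continuity keeps \<open>F\<close> below 1/2
    on a short interval next to 0, where the survival function is then at least 1/2.\<close>
  have "(F \<longlongrightarrow> F 0) (at_right 0)"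
    using D.cdf_is_right_cont[of 0] by (simp add: cdf continuous_within)
  then have "\<forall>\<^sub>F x in at_right 0. F x < 1 / 2"
    using support[of 0] by (intro order_tendstoD(2)[of F 0]) auto
  then obtain \<delta> where \<delta>: "0 < \<delta>" "\<And>x. 0 < x \<Longrightarrow> x < \<delta> \<Longrightarrow> F x < 1 / 2"
    by (auto simp: eventually_at_right_field)
  have "\<delta> / 2 = (\<integral>x. indicator {0<..<\<delta>} x * (1 / 2) \<partial>lborel)"
    using \<delta>(1) by simp
  also have "\<dots> \<le> (\<integral>x. indicator {0<..} x * (1 - F x) \<partial>lborel)"
  proof (rule integral_mono)
    show "indicator {0<..<\<delta>} x * (1 / 2) \<le> indicator {0<..} x * (1 - F x)" for x
      using \<delta>(2)[of x] F_le_1[of x] by (auto simp: indicator_def)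
  qed (use survival_integral \<delta>(1) in \<open>auto simp: has_bochner_integral_iff\<close>)
  also have "\<dots> = (LBINT x:{0<..}. x * f x)"
    using survival_integral by (rule has_bochner_integral_integral_eq)
  finally show "0 < (LBINT x:{0<..}. x * f x)"
    using \<delta>(1) by simp
qed

text \<open>A dilation preserves the sign of \<open>x\<close>, so the flow never crosses the cut
  that the indicators make at 0. Derivatives have to be examined for positive \<open>x\<close>;
  elsewhere every function is constantly 0 along the flow.\<close>

lemma dilation_smooth_cdfI:
  fixes F f f' :: "real \<Rightarrow> real" and D :: "real measure"
  assumes D: "real_distribution D" and cdf: "cdf D = F"
    and support: "\<And>x. x \<le> 0 \<Longrightarrow> F x = 0"
    and deriv1: "\<And>x. x > 0 \<Longrightarrow> (F has_real_derivative f x) (at x)"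
    and deriv2: "\<And>x. x > 0 \<Longrightarrow> (f has_real_derivative f' x) (at x)"
    and cont: "continuous_on {0<..} f'"
    and bdd1: "bounded (f ` {0<..})"
    and bdd2: "bounded (f' ` {0<..})"
    and int1: "set_integrable lborel {0<..} (\<lambda>x. x * f x)"
    and int2: "set_integrable lborel {0<..} (\<lambda>x. x\<^sup>2 * (f x + x * f' x)\<^sup>2)"
  shows "\<exists>K. dilation_smooth_cdf F (\<lambda>x. indicator {0<..} x * (x * f x))
           (\<lambda>x. indicator {0<..} x * (x * (f x + x * f' x))) K"
proof -
  interpret D: real_distribution D by fact
  obtain B1 B2 where B: "\<And>x. 0 < x \<Longrightarrow> \<bar>f x\<bar> \<le> B1" "\<And>x. 0 < x \<Longrightarrow> \<bar>f' x\<bar> \<le> B2"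
    using bdd1 bdd2 by (auto simp: bounded_iff)
  define K where "K = max B1 B2"
  have K: "\<bar>f x\<bar> \<le> K" "\<bar>f' x\<bar> \<le> K" if "0 < x" for x
    using B[OF that] by (auto simp: K_def)
  have f_cont: "isCont f x" "isCont f' x" if "0 < x" for x
    using DERIV_isCont[OF deriv2[OF that]] continuous_on_interior[OF cont, of x] that by (auto simp: interior_open)
  let ?g = "\<lambda>x. indicator {0<..} x * (x * f x)" and ?h = "\<lambda>x. indicator {0<..} x * (x * (f x + x * f' x))"
  have ind: "indicator {0<..} (x * exp s) = (indicator {0<..} x :: real)" for x s :: real
    by (auto simp: indicator_def zero_less_mult_iff)
  have flow: "((\<lambda>s. x * exp s) has_real_derivative x * exp s) (at s)" for x s :: real
    by (auto intro!: derivative_eq_intros)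
  have "dilation_smooth_cdf F ?g ?h K"
  proof
    show "mono F" "0 \<le> F x" "F x \<le> 1" for x
      unfolding cdf[symmetric] by (auto intro!: monoI D.cdf_nondecreasing D.cdf_nonneg D.cdf_bounded_prob)
    show "F x = 0" if "x \<le> 0" for x
      using that by (rule support)
    show "((\<lambda>s. F (x * exp s)) has_real_derivative ?g (x * exp s)) (at s)" for x s
    proof (cases "0 < x")
      case True
      then show ?thesis
        using DERIV_chain2[OF deriv1 flow, of x s] by (simp add: ind mult.commute)
    qed (simp add: ind support mult_nonpos_nonneg)
    show "((\<lambda>s. ?g (x * exp s)) has_real_derivative ?h (x * exp s)) (at s)" for x s
    proof (cases "0 < x")
      case True
      then have "((\<lambda>s. f (x * exp s)) has_real_derivative f' (x * exp s) * (x * exp s)) (at s)"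
        using DERIV_chain2[OF deriv2 flow, of x s] by simp
      from DERIV_mult[OF flow this] show ?thesis
        using True by (simp add: ind algebra_simps)
    qed (simp add: ind)
    show "isCont (\<lambda>s. ?h (x * exp s)) s" for x s
    proof (cases "0 < x")
      case True
      then have "isCont (\<lambda>s. f (x * exp s)) s" "isCont (\<lambda>s. f' (x * exp s)) s"
        using isCont_o2[OF DERIV_isCont[OF flow] f_cont(1), of x s] isCont_o2[OF DERIV_isCont[OF flow] f_cont(2), of x s]
        by simp_all
      then show ?thesis
        by (simp add: ind)
    qed (simp add: ind)
    have "continuous_on {0<..} (\<lambda>x. x * f x)" "continuous_on {0<..} (\<lambda>x. x * (f x + x * f' x))"
      using f_cont by (auto intro!: continuous_at_imp_continuous_on)
    from this[THEN borel_measurable_continuous_on_indicator[rotated]]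
    show "?g \<in> borel_measurable borel" "?h \<in> borel_measurable borel"
      by simp_all
    show "integrable lborel ?g"
      using int1 by (simp add: set_integrable_def)
    have "(\<lambda>x. indicator {0<..} x *\<^sub>R (x\<^sup>2 * (f x + x * f' x)\<^sup>2)) = (\<lambda>x. (?h x)\<^sup>2)"
      by (auto simp: indicator_def power_mult_distrib)
    then show "integrable lborel (\<lambda>x. (?h x)\<^sup>2)"
      using int2 by (simp only: set_integrable_def)
    show "\<bar>?g x\<bar> \<le> K * \<bar>x\<bar>" for x
      using mult_right_mono[OF K(1)[of x], of "\<bar>x\<bar>"] K(1)[of 1]
      by (cases "0 < x") (auto simp: abs_mult mult.commute intro!: mult_nonneg_nonpos)
    show "\<bar>?h x\<bar> \<le> K * (\<bar>x\<bar> + x\<^sup>2)" for x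
    proof (cases "0 < x")
      case True
      have "\<bar>f x + x * f' x\<bar> \<le> K + x * K"
        using K[OF True] True
        by (intro order_trans[OF abs_triangle_ineq] add_mono) (auto simp: abs_mult)
      then have "x * \<bar>f x + x * f' x\<bar> \<le> x * (K + x * K)"
        using True by (intro mult_left_mono) auto
      moreover have "\<bar>?h x\<bar> = x * \<bar>f x + x * f' x\<bar>"
        using True by (simp add: abs_mult)
      moreover have "x * (K + x * K) = K * (\<bar>x\<bar> + x\<^sup>2)"
        using True by (simp add: power2_eq_square algebra_simps)
      ultimately show ?thesis
        by linarith
    next
      case False
      have "0 \<le> K * (\<bar>x\<bar> + x\<^sup>2)"
        using K(1)[of 1] by (intro mult_nonneg_nonneg add_nonneg_nonneg) auto
      then show ?thesis
        using False by simp
    qed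
    show "has_bochner_integral lborel (\<lambda>x. indicator {0<..} x * (1 - F x)) (\<integral>x. ?g x \<partial>lborel)"
      using survival_integral_of_density(1)[OF D cdf support deriv1 deriv2 int1]
      by (simp add: set_lebesgue_integral_def)
  qed
  then show ?thesis ..
qed

theorem proposition6p3:
  fixes M :: "'a measure"
    and X :: "nat \<Rightarrow> 'a \<Rightarrow> real"
    and F f f' :: "real \<Rightarrow> real"
    and b :: "nat \<Rightarrow> real"
  assumes "prob_space M"
    and indep: "prob_space.indep_vars M (\<lambda>_. borel) X {1..}"
    and cdf: "\<And>i. i \<ge> 1 \<Longrightarrow> cdf (distr M borel (X i)) = F"
    and support: "\<And>x. x \<le> 0 \<Longrightarrow> F x = 0"
    and deriv1: "\<And>x. x > 0 \<Longrightarrow> (F has_real_derivative f x) (at x)"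
    and deriv2: "\<And>x. x > 0 \<Longrightarrow> (f has_real_derivative f' x) (at x)"
    and cont: "continuous_on {0<..} f'"
    and bdd1: "bounded (f ` {0<..})"
    and bdd2: "bounded (f' ` {0<..})"
    and b_pos: "\<And>n. n \<ge> 1 \<Longrightarrow> b n > 0"
    and b_lim: "b \<longlonglongrightarrow> 0"
    and int1: "set_integrable lborel {0<..} (\<lambda>x. x * f x)"
    and int2: "set_integrable lborel {0<..} (\<lambda>x. x\<^sup>2 * (f x + x * f' x)\<^sup>2)"
  shows "set_integrable lborel {0<..} (\<lambda>x. F x * (1 - F x)) \<and>
         (\<forall>n\<ge>1. MISE M F (LN_estimator X n (b n)) < \<infinity> \<and>
           MISE M F (LN_estimator X n (b n)) =
             (\<integral>\<^sup>+x\<in>{0<..}. ennreal (prob_space.variance M (\<lambda>\<omega>. LN_estimator X n (b n) \<omega> x)) \<partial>lborel)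
             + (\<integral>\<^sup>+x\<in>{0<..}. ennreal ((bias M F (LN_estimator X n (b n)) x)\<^sup>2) \<partial>lborel)) \<and>
         (\<exists>R1 R2. R1 \<in> o(\<lambda>n. (1 / real n) * sqrt (b n)) \<and> R2 \<in> o(\<lambda>n. (b n)\<^sup>2) \<and>
           (\<forall>n\<ge>1. enn2real (MISE M F (LN_estimator X n (b n))) =
              (1 / real n) * (LBINT x:{0<..}. F x * (1 - F x))
              - (1 / real n) * sqrt (b n) * (LBINT x:{0<..}. x * f x / sqrt pi)
              + (b n)\<^sup>2 * (LBINT x:{0<..}. x\<^sup>2 / 4 * (f x + x * f' x)\<^sup>2)
              + R1 n + R2 n)) \<and>
         ((LBINT x:{0<..}. x\<^sup>2 * (f x + x * f' x)\<^sup>2) > 0 \<longrightarrow>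
           (\<forall>n\<ge>1. \<forall>c. is_arg_min (LN_AMISE F f f' n) (\<lambda>c. c > 0) c \<longleftrightarrow> c = LN_b_opt f f' n) \<and>
           (\<forall>n\<ge>1. MISE M F (LN_estimator X n (LN_b_opt f f' n)) < \<infinity>) \<and>
           (\<lambda>n. enn2real (MISE M F (LN_estimator X n (LN_b_opt f f' n)))
              - ((1 / real n) * (LBINT x:{0<..}. F x * (1 - F x))
                 - real n powr (- 4 / 3) * (3 / 4)
                   * (LN_var_const f ^ 4 / (4 * LN_bias_const f f')) powr (1 / 3)))
             \<in> o(\<lambda>n. real n powr (- 4 / 3)))"
proof -
  interpret prob_space M by fact
  have X1: "random_variable borel (X 1)"
    using indep by (auto simp: indep_vars_def)
  note D = real_distribution_distr[OF X1]
  define g where "g x = indicator {0<..} x * (x * f x)" for x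
  define h where "h x = indicator {0<..} x * (x * (f x + x * f' x))" for x
  obtain K where "dilation_smooth_cdf F g h K"
    unfolding g_def[abs_def] h_def[abs_def]
    using dilation_smooth_cdfI[OF D cdf[of 1] support deriv1 deriv2 cont bdd1 bdd2 int1 int2] by auto
  then interpret LN_sample M F g h K X
    using indep cdf by (intro LN_sample.intro LN_sample_axioms.intro) (auto intro: prob_space_axioms)
  let ?A = "LBINT x:{0<..}. F x * (1 - F x)"
  \<comment> \<open>\<open>F\<close> vanishes where the indicator does, so the set integral is the
    integral over the whole line.\<close>
  have A_integrand: "indicator {0<..} x *\<^sub>R (F x * (1 - F x)) = F x * (1 - F x)" for x
    using support[of x] by (auto simp: indicator_def)
  have A: "?A = (\<integral>x. F x * (1 - F x) \<partial>lborel)"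
    by (simp only: set_lebesgue_integral_def A_integrand)
  have mean_eq: "mean = (LBINT x:{0<..}. x * f x)"
    by (simp add: mean_def g_def set_lebesgue_integral_def)
  have V: "LN_var_const f = mean / sqrt pi"
    by (simp add: LN_var_const_def mean_eq)
  have h2: "(h x)\<^sup>2 = indicator {0<..} x * (x\<^sup>2 * (f x + x * f' x)\<^sup>2)" for x
    by (simp add: h_def indicator_def power_mult_distrib)
  have C: "LN_bias_const f f' = (\<integral>x. (h x)\<^sup>2 / 4 \<partial>lborel)"
    by (simp add: LN_bias_const_def set_lebesgue_integral_def h2)
  have H: "(LBINT x:{0<..}. x\<^sup>2 * (f x + x * f' x)\<^sup>2) = 4 * LN_bias_const f f'"
    by (simp add: C set_lebesgue_integral_def h2)
  have "set_integrable lborel {0<..} (\<lambda>x. F x * (1 - F x))"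
    using integrable_F_variance by (simp only: set_integrable_def A_integrand)
  moreover have "MISE M F (LN_estimator X n (b n)) < \<infinity> \<and>
      MISE M F (LN_estimator X n (b n)) =
        (\<integral>\<^sup>+x\<in>{0<..}. ennreal (prob_space.variance M (\<lambda>\<omega>. LN_estimator X n (b n) \<omega> x)) \<partial>lborel)
        + (\<integral>\<^sup>+x\<in>{0<..}. ennreal ((bias M F (LN_estimator X n (b n)) x)\<^sup>2) \<partial>lborel)" if "1 \<le> n" for n
    using MISE_expansion(4)[OF b_pos b_lim that] MISE_LN_estimator(1)[OF that b_pos[OF that]] by blast
  moreover have "\<exists>R1 R2. R1 \<in> o(\<lambda>n. (1 / real n) * sqrt (b n)) \<and> R2 \<in> o(\<lambda>n. (b n)\<^sup>2) \<and>
      (\<forall>n\<ge>1. enn2real (MISE M F (LN_estimator X n (b n))) =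
        (1 / real n) * ?A
        - (1 / real n) * sqrt (b n) * (LBINT x:{0<..}. x * f x / sqrt pi)
        + (b n)\<^sup>2 * (LBINT x:{0<..}. x\<^sup>2 / 4 * (f x + x * f' x)\<^sup>2)
        + R1 n + R2 n)"
    unfolding A V[unfolded LN_var_const_def] C[unfolded LN_bias_const_def]
    using MISE_expansion[OF b_pos b_lim] by blast
  moreover have "(\<forall>n\<ge>1. \<forall>c. is_arg_min (LN_AMISE F f f' n) (\<lambda>c. c > 0) c \<longleftrightarrow> c = LN_b_opt f f' n) \<and>
      (\<forall>n\<ge>1. MISE M F (LN_estimator X n (LN_b_opt f f' n)) < \<infinity>) \<and>
      (\<lambda>n. enn2real (MISE M F (LN_estimator X n (LN_b_opt f f' n)))
         - ((1 / real n) * ?A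
            - real n powr (- 4 / 3) * (3 / 4)
              * (LN_var_const f ^ 4 / (4 * LN_bias_const f f')) powr (1 / 3)))
        \<in> o(\<lambda>n. real n powr (- 4 / 3))"
    if "0 < (LBINT x:{0<..}. x\<^sup>2 * (f x + x * f' x)\<^sup>2)"
  proof -
    let ?b = "LN_b_opt f f'"
    define c where "c = (4 * LN_bias_const f f' / LN_var_const f) powr (- 2 / 3)"
    have V_pos: "0 < LN_var_const f"
      using survival_integral_of_density(2)[OF D cdf[of 1] support deriv1 deriv2 int1]
      by (simp add: V mean_eq)
    have C_pos: "0 < LN_bias_const f f'"
      using that by (simp add: H)
    note min = LN_AMISE_minimizer[OF V_pos C_pos]
    have c_pos: "0 < c"
      unfolding c_def using V_pos C_pos by simp
    have b_eq: "?b n = real n powr (- 2 / 3) * c" for n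
      by (simp add: LN_b_opt_def c_def)
    have b_opt_pos: "0 < ?b n" if "1 \<le> n" for n
      using min(1,2)[OF that] by simp
    \<comment> \<open>The expansion holds for any positive null sequence, hence also for the optimal
      bandwidths.\<close>
    note expansion = MISE_expansion[OF b_opt_pos tendsto_LN_b_opt]
    obtain R1 R2 where R1: "R1 \<in> o(\<lambda>n. (1 / real n) * sqrt (?b n))" and R2: "R2 \<in> o(\<lambda>n. (?b n)\<^sup>2)"
      and R: "\<And>n. 1 \<le> n \<Longrightarrow> enn2real (MISE M F (LN_estimator X n (?b n))) = LN_AMISE F f f' n (?b n) + R1 n + R2 n"
      unfolding LN_AMISE_def A V C using expansion by blast
    have n_pos: "\<forall>\<^sub>F n in sequentially. 1 \<le> n"
      by (rule eventually_ge_at_top)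
    \<comment> \<open>At \<open>b = c * n powr (- 2 / 3)\<close> the two error scales balance: both
      are constant multiples of \<open>n powr (- 4 / 3)\<close>.\<close>
    have ev1: "\<forall>\<^sub>F n in sequentially. (1 / real n) * sqrt (?b n) = sqrt c * real n powr (- 4 / 3)"
      using n_pos
    proof eventually_elim
      case (elim n)
      have "sqrt (?b n) = (real n powr (- 2 / 3)) powr (1 / 2) * sqrt c"
        by (simp add: b_eq real_sqrt_mult powr_half_sqrt)
      also have "\<dots> = real n powr (- 1 / 3) * sqrt c"
        by (simp add: powr_powr)
      finally have "(1 / real n) * sqrt (?b n) = (real n powr (- 1) * real n powr (- 1 / 3)) * sqrt c"
        using elim by (simp add: powr_minus_divide)
      also have "real n powr (- 1) * real n powr (- 1 / 3) = real n powr (- 4 / 3)"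
        by (subst powr_add[symmetric]) simp
      finally show ?case
        by simp
    qed
    have "R1 \<in> o(\<lambda>n. sqrt c * real n powr (- 4 / 3))"
      using R1 unfolding landau_o.small.cong[OF ev1] .
    then have R1': "R1 \<in> o(\<lambda>n. real n powr (- 4 / 3))"
      using c_pos by simp
    have "(?b n)\<^sup>2 = c\<^sup>2 * real n powr (- 4 / 3)" for n
      by (simp add: b_eq power_mult_distrib power2_eq_square[of "real n powr _"] flip: powr_add)
    with R2 have R2': "R2 \<in> o(\<lambda>n. real n powr (- 4 / 3))"
      using c_pos by simp
    have sum: "(\<lambda>n. R1 n + R2 n) \<in> o(\<lambda>n. real n powr (- 4 / 3))"
      using R1' R2' by (rule sum_in_smallo)
    have ev: "\<forall>\<^sub>F n in sequentially. R1 n + R2 n = enn2real (MISE M F (LN_estimator X n (?b n)))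
         - ((1 / real n) * ?A
            - real n powr (- 4 / 3) * (3 / 4)
              * (LN_var_const f ^ 4 / (4 * LN_bias_const f f')) powr (1 / 3))"
      using n_pos
    proof eventually_elim
      case (elim n)
      then show ?case
        using R[OF elim] min(3)[OF elim, of F, folded min(2)[OF elim]] by simp
    qed
    have "(\<lambda>n. enn2real (MISE M F (LN_estimator X n (?b n)))
         - ((1 / real n) * ?A
            - real n powr (- 4 / 3) * (3 / 4)
              * (LN_var_const f ^ 4 / (4 * LN_bias_const f f')) powr (1 / 3)))
        \<in> o(\<lambda>n. real n powr (- 4 / 3))"
      using landau_o.small.in_cong[OF ev] sum by (rule iffD1)
    then show ?thesis
      using min(4) expansion(4) by blast
  qed
  ultimately show ?thesis
    by blast
qed

end
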